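(* Let $\omega>-m^{2s}$. Assume that $u\in\mathcal{L}_s(\mathbb{R}^3)\cap C^{1,1}_{loc}(\mathbb{R}^3)$ is a nonnegative solution of $$(-\Delta+m^2)^s u+\omega u=\left(\frac{1}{|x|}*u^2\right)u\qquad\text{in }\mathbb{R}^3$$ satisfying $$\int_{\mathbb{R}^3}\frac{u(x)}{|x|^2}\,dx<+\infty\qquad\text{and}\qquad u(x)=o\left(\frac1{|x|}\right)\ \text{as }|x|\to\infty.$$ Then $u$ is radially symmetric and monotone decreasing about some point in $\mathbb{R}^3$.
   Context: Here $N=3$, $0<s<1$, $m>0$. The symbol $*$ is convolution on $\mathbb{R}^3$: $\left(\frac1{|x|}*u^2\right)(x)=\int_{\mathbb{R}^3}\frac{u^2(y)}{|x-y|}dy$. $K_\nu$ is the modified Bessel function of the second kind of order $\nu$, $K_\nu(r)=\int_0^\infty e^{-r\cosh t}\cosh(\nu t)\,dt$ for $r>0$. The operator $(-\Delta+m^2)^s$ is defined (with $N=3$) by $$(-\Delta+m^2)^s u(x)=c_{N,s}m^{\frac N2+s}\,\mathrm{P.V.}\int_{\mathbb{R}^N}\frac{u(x)-u(y)}{|x-y|^{\frac N2+s}}K_{\frac N2+s}(m|x-y|)\,dy+m^{2s}u(x),\qquad c_{N,s}=2^{1-\frac N2+s}\pi^{-\frac N2}\frac{s(1-s)}{\Gamma(2-s)},$$ where P.V. denotes the Cauchy principal value. The function space is $\mathcal{L}_s(\mathbb{R}^N)=\{u:\mathbb{R}^N\to\mathbb{R}\,:\,\int_{\mathbb{R}^N}\frac{e^{-|x|}|u(x)|}{1+|x|^{\frac{N+1}2+s}}dx<\infty\}$.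 $C^{1,1}_{loc}$ denotes $C^1$ functions with locally Lipschitz gradient. *)

theory Defs
  imports "HOL-Analysis.Analysis" "HOL-Library.Landau_Symbols"
begin

definition bessel_K :: "real \<Rightarrow> real \<Rightarrow> real" where
  "bessel_K \<nu> r = (LINT t:{0<..}|lebesgue. exp (- r * cosh t) * cosh (\<nu> * t))"

definition frac_const :: "real \<Rightarrow> real \<Rightarrow> real" where
  "frac_const N s = 2 powr (1 - N / 2 + s) * pi powr (- N / 2) * (s * (1 - s) / Gamma (2 - s))"

text \<open>Cauchy principal value at the singular point \<open>x\<close>: the limit, as \<open>\<epsilon>\<close> decreases to 0, of the
  integral over the complement of the ball of radius \<open>\<epsilon>\<close> around \<open>x\<close>.\<close>

definition pv_truncated :: "'a::euclidean_space \<Rightarrow> ('a \<Rightarrow> real) \<Rightarrow> real \<Rightarrow> real" where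
  "pv_truncated x f \<epsilon> = (LINT y:{y. \<epsilon> < norm (x - y)}|lebesgue. f y)"

definition pv_integrable :: "'a::euclidean_space \<Rightarrow> ('a \<Rightarrow> real) \<Rightarrow> bool" where
  "pv_integrable x f \<longleftrightarrow>
     (\<forall>\<epsilon>>0. set_integrable lebesgue {y. \<epsilon> < norm (x - y)} f) \<and>
     (\<exists>L. (pv_truncated x f \<longlongrightarrow> L) (at_right 0))"

definition pv_integral :: "'a::euclidean_space \<Rightarrow> ('a \<Rightarrow> real) \<Rightarrow> real" where
  "pv_integral x f = Lim (at_right 0) (pv_truncated x f)"

text \<open>The operator \<open>(- \<Delta> + m\<^sup>2)\<^sup>s\<close> on \<open>N\<close>-dimensional Euclidean space, \<open>N = DIM('a)\<close>. Its value at
  \<open>x\<close> is meaningful only if the integrand is \<^const>\<open>pv_integrable\<close> at \<open>x\<close>.\<close>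

definition frac_integrand ::
  "real \<Rightarrow> real \<Rightarrow> ('a::euclidean_space \<Rightarrow> real) \<Rightarrow> 'a \<Rightarrow> 'a \<Rightarrow> real" where
  "frac_integrand m s u x y =
     (u x - u y) / norm (x - y) powr (real DIM('a) / 2 + s)
       * bessel_K (real DIM('a) / 2 + s) (m * norm (x - y))"

definition frac_op ::
  "real \<Rightarrow> real \<Rightarrow> ('a::euclidean_space \<Rightarrow> real) \<Rightarrow> 'a \<Rightarrow> real" where
  "frac_op m s u x =
     frac_const (real DIM('a)) s * m powr (real DIM('a) / 2 + s)
       * pv_integral x (frac_integrand m s u x)
     + m powr (2 * s) * u x"

definition L_space :: "real \<Rightarrow> ('a::euclidean_space \<Rightarrow> real) set" where
  "L_space s = {u. integrable lebesgue
     (\<lambda>x. exp (- norm x) * \<bar>u x\<bar> / (1 + norm x powr ((real DIM('a) + 1) / 2 + s)))}"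

definition C11_loc :: "('a::euclidean_space \<Rightarrow> real) set" where
  "C11_loc = {u. \<exists>g. (\<forall>x. GDERIV u x :> g x) \<and> continuous_on UNIV g \<and>
     (\<forall>x. \<exists>r>0. \<exists>L. L-lipschitz_on (ball x r) g)}"

definition hartree_potential :: "(real^3 \<Rightarrow> real) \<Rightarrow> real^3 \<Rightarrow> real" where
  "hartree_potential u x = (LINT y|lebesgue. (u y)\<^sup>2 / norm (x - y))"

text \<open>Pointwise solutions. The first two conjuncts say that both sides of the equation are well
  defined at \<open>x\<close>.\<close>

definition hartree_solution :: "real \<Rightarrow> real \<Rightarrow> real \<Rightarrow> (real^3 \<Rightarrow> real) \<Rightarrow> bool" where
  "hartree_solution m s \<omega> u \<longleftrightarrow> (\<forall>x.
     pv_integrable x (frac_integrand m s u x) \<and>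
     integrable lebesgue (\<lambda>y. (u y)\<^sup>2 / norm (x - y)) \<and>
     frac_op m s u x + \<omega> * u x = hartree_potential u x * u x)"

text \<open>Decreasing is understood in the non-strict sense; the zero function is an instance.\<close>

definition radially_decreasing_about :: "'a::euclidean_space \<Rightarrow> ('a \<Rightarrow> real) \<Rightarrow> bool" where
  "radially_decreasing_about p u \<longleftrightarrow>
     (\<exists>\<phi>::real \<Rightarrow> real. antimono_on {0..} \<phi> \<and> (\<forall>x. u x = \<phi> (norm (x - p))))"

end

theory Submission
  imports Defs
begin

text \<open>The proof is the direct method of moving planes. Fix a unit vector \<open>e\<close>. For the plane
  \<open>e \<bullet> y = l\<close> with reflection \<open>R\<close>, consider the gap \<open>w x = u (R x) - u x\<close> on the half space
  \<open>e \<bullet> x \<le> l\<close>. It vanishes on the plane and is at least \<open>- u\<close>, so if it is negative somewhere it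
  attains a negative minimum at an interior point \<open>x\<close>, at some distance \<open>d\<close> from the plane.

  Subtract the equations at \<open>R x\<close> and at \<open>x\<close>. The kernel of the operator is positive, strictly
  decreasing and more singular than \<open>norm z\<close> to the power \<open>-3\<close>, so folding the principal value
  integrals along the plane gives at most \<open>w x\<close> times a factor that tends to infinity as \<open>d\<close> tends
  to 0 (\<open>pv_op_gap\<close>). Folding the Hartree potential shows that from \<open>x\<close> to \<open>R x\<close> it drops by at
  most a multiple of \<open>\<bar>w x\<bar> d\<close> times the Riesz potential of \<open>u\<close> (\<open>hartree_potential_gap\<close>).
  Dividing by \<open>w x\<close>, one finds (\<open>negative_minimum_estimate\<close>), with \<open>\<mu> = m powr (2 s) + \<omega> > 0\<close>,

  \<open>const * d\<^sup>3 j (3 d) + \<mu> \<le> hartree_potential u x + 4 u x d riesz_potential x\<close>.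

  Integrability of \<open>u / (norm x)\<^sup>2\<close> together with \<open>u = o(1 / norm x)\<close> bounds the Riesz potential
  and makes the right-hand side bounded and small at infinity (\<open>coefficient_bounds\<close>). Hence
  negative minima stay in a fixed ball and at a fixed distance from the plane, as long as \<open>l\<close> is
  bounded above (\<open>negative_minimum_location\<close>). The first property lets the method start at very
  negative \<open>l\<close>. Unless \<open>u = 0\<close>, the plane cannot move forever, because \<open>u\<close> tends to 0. At the
  critical position the gap vanishes identically: otherwise it is positive by the strong maximum
  principle, and a limit of negative minima for later planes is a contradiction
  (\<open>critical_plane\<close>).

  So \<open>u\<close> is symmetric about a plane in every direction and increases towards it. As a nonzero
  function that tends to 0 has no period, all these planes pass through one point, which gives
  radial symmetry and monotonicity.\<close>

section \<open>Reflections in planes\<close>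

text \<open>Reflection in the plane \<open>e \<bullet> y = l\<close>, for a unit vector \<open>e\<close>.\<close>
definition mirror :: "'a::euclidean_space \<Rightarrow> real \<Rightarrow> 'a \<Rightarrow> 'a" where
  "mirror e l x = x + (2 * (l - e \<bullet> x)) *\<^sub>R e"

lemma inner_mirror: "norm e = 1 \<Longrightarrow> e \<bullet> mirror e l x = 2 * l - e \<bullet> x"
  by (simp add: mirror_def inner_add_right dot_square_norm)

lemma mirror_mirror [simp]: "norm e = 1 \<Longrightarrow> mirror e l (mirror e l x) = x"
proof -
  assume "norm e = 1"
  then have "2 * (l - e \<bullet> mirror e l x) = - (2 * (l - e \<bullet> x))"
    by (simp add: inner_mirror)
  then have "mirror e l (mirror e l x) = mirror e l x + (- (2 * (l - e \<bullet> x))) *\<^sub>R e"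
    by (simp only: mirror_def[of e l "mirror e l x"])
  also have "\<dots> = x"
    by (simp only: mirror_def scaleR_minus_left add_uminus_conv_diff add_diff_cancel)
  finally show ?thesis .
qed

lemma norm_diff_scaleR_unit_sq:
  assumes "norm e = 1"
  shows "(norm (z - k *\<^sub>R e))\<^sup>2 = (norm z)\<^sup>2 - 2 * k * (e \<bullet> z) + k\<^sup>2"
proof -
  have e: "e \<bullet> e = 1" using assms by (simp add: dot_square_norm)
  show ?thesis
    unfolding power2_norm_eq_inner using e
    by (simp add: inner_diff_left inner_diff_right inner_commute algebra_simps power2_eq_square)
qed

lemma norm_mirror_diff:
  assumes "norm e = 1" shows "norm (mirror e l x - mirror e l y) = norm (x - y)"
proof -
  define z k where "z = x - y" and "k = 2 * (e \<bullet> z)"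
  have "mirror e l x - mirror e l y = z - k *\<^sub>R e"
    by (simp add: mirror_def z_def k_def algebra_simps)
  then have "(norm (mirror e l x - mirror e l y))\<^sup>2 = (norm z)\<^sup>2 - 2 * k * (e \<bullet> z) + k\<^sup>2"
    by (simp only: norm_diff_scaleR_unit_sq[OF assms])
  also have "\<dots> = (norm z)\<^sup>2" by (simp add: k_def power2_eq_square)
  finally have "(norm (mirror e l x - mirror e l y))\<^sup>2 = (norm z)\<^sup>2" .
  then show ?thesis by (simp add: z_def)
qed

lemma norm_diff_mirror_commute:
  assumes "norm e = 1" shows "norm (x - mirror e l y) = norm (mirror e l x - y)"
  using norm_mirror_diff[OF assms, of l x "mirror e l y"] assms by simp

text \<open>The product of the signed distances of \<open>x\<close> and \<open>y\<close> from the plane decides which of \<open>y\<close> and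
  its mirror image is closer to \<open>x\<close>; every comparison of kernels below goes back to this identity.\<close>
lemma norm_diff_mirror_sq:
  assumes "norm e = 1"
  shows "(norm (x - mirror e l y))\<^sup>2 = (norm (x - y))\<^sup>2 + 4 * (l - e \<bullet> x) * (l - e \<bullet> y)"
proof -
  define k where "k = 2 * (l - e \<bullet> y)"
  have "x - mirror e l y = (x - y) - k *\<^sub>R e"
    by (simp add: mirror_def k_def algebra_simps)
  then have "(norm (x - mirror e l y))\<^sup>2 = (norm (x - y))\<^sup>2 - 2 * k * (e \<bullet> (x - y)) + k\<^sup>2"
    using norm_diff_scaleR_unit_sq[OF assms, of "x - y" k] by (simp only:)
  then show ?thesis by (simp add: k_def inner_diff_right power2_eq_square algebra_simps)
qed

lemma norm_diff_le_mirror: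
  assumes "norm e = 1" "e \<bullet> x \<le> l" "e \<bullet> y \<le> l"
  shows "norm (x - y) \<le> norm (x - mirror e l y)"
proof -
  have "0 \<le> 4 * (l - e \<bullet> x) * (l - e \<bullet> y)" using assms by simp
  then have "(norm (x - y))\<^sup>2 \<le> (norm (x - mirror e l y))\<^sup>2"
    unfolding norm_diff_mirror_sq[OF assms(1)] by linarith
  then show ?thesis by (rule power2_le_imp_le) simp
qed

lemma norm_diff_less_mirror:
  assumes "norm e = 1" "e \<bullet> x < l" "e \<bullet> y < l"
  shows "norm (x - y) < norm (x - mirror e l y)"
proof -
  have "0 < 4 * (l - e \<bullet> x) * (l - e \<bullet> y)" using assms by simp
  then have "(norm (x - y))\<^sup>2 < (norm (x - mirror e l y))\<^sup>2"
    unfolding norm_diff_mirror_sq[OF assms(1)] by linarith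
  then show ?thesis by (rule power2_less_imp_less) simp
qed

lemma norm_self_diff_mirror: "norm e = 1 \<Longrightarrow> norm (x - mirror e l x) = 2 * \<bar>l - e \<bullet> x\<bar>"
  by (auto simp: mirror_def abs_if)

lemma plane_dist_le_norm_diff_mirror:
  assumes "norm e = 1" "e \<bullet> x \<le> l" "e \<bullet> y \<le> l"
  shows "l - e \<bullet> x \<le> norm (x - mirror e l y)"
proof -
  have "e \<bullet> (mirror e l y - x) \<le> norm (mirror e l y - x)"
    using norm_cauchy_schwarz[of e] assms(1) by simp
  then show ?thesis
    using assms by (simp add: inner_diff_right inner_mirror norm_minus_commute)
qed

lemma continuous_on_mirror [continuous_intros]:
  "continuous_on S f \<Longrightarrow> continuous_on S g \<Longrightarrow> continuous_on S (\<lambda>z. mirror e (f z) (g z))"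
  unfolding mirror_def by (intro continuous_intros)

text \<open>A reflection is an orthogonal map followed by a translation. Equality of measures
  transfers to sets of infinite measure because a reflection is its own inverse.\<close>
lemma
  fixes e :: "real^'n::{finite,wellorder}"
  assumes e: "norm e = 1" and S: "S \<in> sets lebesgue"
  shows sets_lebesgue_mirror_image: "mirror e l ` S \<in> sets lebesgue"
    and emeasure_mirror_image: "emeasure lebesgue (mirror e l ` S) = emeasure lebesgue S"
proof -
  let ?f = "\<lambda>x. x - (2 * (e \<bullet> x)) *\<^sub>R e"
  have ot: "orthogonal_transformation ?f"
    unfolding orthogonal_transformation
  proof
    show "linear ?f"
      by (auto intro!: linearI simp: algebra_simps inner_add_right)
    show "\<forall>v. norm (?f v) = norm v"
      using norm_mirror_diff[OF e, of 0 _ 0] by (simp add: mirror_def)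
  qed
  have img: "mirror e l ` S = (+) ((2 * l) *\<^sub>R e) ` ?f ` S" for S
    by (auto simp: mirror_def image_iff algebra_simps)
  have sets: "mirror e l ` S \<in> sets lebesgue" if "S \<in> sets lebesgue" for S
    unfolding img
    by (intro lebesgue_sets_translation differentiable_image_in_sets_lebesgue that)
       (auto intro!: linear_imp_differentiable_on orthogonal_transformation_linear ot)
  have lm: "mirror e l ` S \<in> lmeasurable \<and> measure lebesgue (mirror e l ` S) = measure lebesgue S"
    if "S \<in> lmeasurable" for S
    using measurable_orthogonal_image[OF ot that] measure_orthogonal_image[OF ot that]
    unfolding img by (auto simp: measurable_translation measure_translation)
  have invol: "mirror e l ` mirror e l ` S = S" for S
    using e by (simp add: image_image)
  show "mirror e l ` S \<in> sets lebesgue" by (rule sets[OF S])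
  show "emeasure lebesgue (mirror e l ` S) = emeasure lebesgue S"
  proof (cases "S \<in> lmeasurable")
    case True
    then show ?thesis using lm[OF True]
      by (simp add: emeasure_eq_measure2)
  next
    case False
    then have "mirror e l ` S \<notin> lmeasurable" using lm[of "mirror e l ` S"] invol by auto
    then show ?thesis using False S sets[OF S]
      by (auto simp: fmeasurable_def less_top[symmetric] simp del: emeasure_completion)
  qed
qed

lemma distr_mirror:
  fixes e :: "real^'n::{finite,wellorder}"
  assumes e: "norm e = 1"
  shows "mirror e l \<in> measurable lebesgue lebesgue" "distr lebesgue lebesgue (mirror e l) = lebesgue"
proof -
  have vim: "mirror e l -` S = mirror e l ` S" for S
    using e by (auto simp: image_iff) (metis mirror_mirror)
  show m: "mirror e l \<in> measurable lebesgue lebesgue"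
    using sets_lebesgue_mirror_image[OF e] by (auto simp: measurable_def vim)
  show "distr lebesgue lebesgue (mirror e l) = lebesgue"
    by (rule measure_eqI) (auto simp: emeasure_distr m vim emeasure_mirror_image[OF e])
qed

lemma
  fixes e :: "real^'n::{finite,wellorder}" and f :: "real^'n::{finite,wellorder} \<Rightarrow> real"
  assumes e: "norm e = 1"
  shows integrable_mirror: "integrable lebesgue f \<Longrightarrow> integrable lebesgue (\<lambda>x. f (mirror e l x))"
    and integral_mirror: "integrable lebesgue f \<Longrightarrow> (LINT x|lebesgue. f (mirror e l x)) = (LINT x|lebesgue. f x)"
proof -
  assume f: "integrable lebesgue f"
  show "integrable lebesgue (\<lambda>x. f (mirror e l x))"
    by (rule integrable_distr[OF distr_mirror(1)[OF e]]) (simp add: distr_mirror(2)[OF e] f)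
  show "(LINT x|lebesgue. f (mirror e l x)) = (LINT x|lebesgue. f x)"
    using integral_distr[OF distr_mirror(1)[OF e], of f l] f by (simp add: distr_mirror(2)[OF e])
qed

text \<open>Comparison of integrals by folding along the plane: it suffices to compare the sums of the
  integrands over pairs of mirror points, so a pointwise inequality is needed on one side only.\<close>
lemma integral_mirror_symmetrize:
  fixes e :: "real^'n::{finite,wellorder}" and f :: "real^'n::{finite,wellorder} \<Rightarrow> real"
  assumes e: "norm e = 1" and f: "integrable lebesgue f" and b: "integrable lebesgue b"
    and le: "AE y in lebesgue. f y + f (mirror e l y) \<le> b y + b (mirror e l y)"
  shows "(LINT y|lebesgue. f y) \<le> (LINT y|lebesgue. b y)"
proof -
  have sym: "(LINT y|lebesgue. g y + g (mirror e l y)) = 2 * (LINT y|lebesgue. g y)"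
    "integrable lebesgue (\<lambda>y. g y + g (mirror e l y))"
    if "integrable lebesgue g" for g :: "real^'n::{finite,wellorder} \<Rightarrow> real"
    using that integrable_mirror[OF e that] integral_mirror[OF e that] by simp_all
  have "(LINT y|lebesgue. f y + f (mirror e l y)) \<le> (LINT y|lebesgue. b y + b (mirror e l y))"
    using sym f b le by (intro integral_mono_AE) auto
  then show ?thesis using sym(1)[OF f] sym(1)[OF b] by simp
qed

section \<open>The Bessel kernel\<close>

definition bessel_integrand :: "real \<Rightarrow> real \<Rightarrow> real \<Rightarrow> real" where
  "bessel_integrand \<nu> r t = indicator {0<..} t * (exp (- r * cosh t) * cosh (\<nu> * t))"

lemma bessel_K_alt: "bessel_K \<nu> r = (LINT t|lebesgue. bessel_integrand \<nu> r t)"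
  by (simp add: bessel_K_def set_lebesgue_integral_def bessel_integrand_def)

text \<open>Domination by \<open>C e\<^sup>-\<^sup>t\<close>: as \<open>cosh t \<ge> t\<^sup>2 / 4\<close> and \<open>cosh (\<nu> t) \<le> e\<^bsup>\<nu> t\<^esup>\<close>, completing the
  square in the exponent gives \<open>C = exp ((\<nu> + 1)\<^sup>2 / r)\<close>.\<close>
lemma integrable_bessel_integrand:
  assumes "r > 0" "\<nu> \<ge> 0"
  shows "integrable lebesgue (bessel_integrand \<nu> r)"
proof -
  define C where "C = exp ((\<nu> + 1)\<^sup>2 / r)"
  have "set_integrable lebesgue {0..} (\<lambda>t::real. exp (- 1 * t))"
    by (rule nonnegative_absolutely_integrable_1)
       (use integrable_on_exp_minus_to_infinity[of 1 0] in auto)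
  then have int: "integrable lebesgue (\<lambda>t::real. C * (indicator {0..} t * exp (- t)))"
    unfolding set_integrable_def by (intro integrable_mult_right) simp
  show "integrable lebesgue (bessel_integrand \<nu> r)"
  proof (rule Bochner_Integration.integrable_bound[OF int])
    have "bessel_integrand \<nu> r \<in> borel_measurable lborel"
      unfolding bessel_integrand_def cosh_def by measurable
    then show "bessel_integrand \<nu> r \<in> borel_measurable lebesgue"
      by (rule measurable_completion)
    show "AE t in lebesgue. norm (bessel_integrand \<nu> r t) \<le> norm (C * (indicator {0..} t * exp (- t)))"
    proof (intro AE_I2)
      fix t :: real
      show "norm (bessel_integrand \<nu> r t) \<le> norm (C * (indicator {0..} t * exp (- t)))"
      proof (cases "t > 0")
        case True
        have "t\<^sup>2 / 4 \<le> cosh t"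
          using exp_lower_Taylor_quadratic[of t] exp_ge_add_one_self[of "- t"] True
          by (simp add: cosh_field_def)
        then have 1: "r * (t\<^sup>2 / 4) \<le> r * cosh t" using assms by simp
        have 2: "cosh (\<nu> * t) \<le> exp (\<nu> * t)" using True assms
          by (simp add: cosh_field_def)
        have "(\<nu> + 1)\<^sup>2 / r - (- r * (t\<^sup>2/4) + \<nu> * t + t) = (\<nu> + 1 - r * t / 2)\<^sup>2 / r"
          using assms by (simp add: field_simps power2_eq_square)
        also have "\<dots> \<ge> 0" using assms by simp
        finally have 3: "- r * (t\<^sup>2/4) + \<nu> * t \<le> (\<nu> + 1)\<^sup>2 / r - t" by simp
        have "exp (- r * cosh t) * cosh (\<nu> * t) \<le> exp (- r * (t\<^sup>2/4)) * exp (\<nu> * t)"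
          using 1 2 by (intro mult_mono) auto
        also have "\<dots> = exp (- r * (t\<^sup>2/4) + \<nu> * t)" by (simp only: exp_add)
        also have "\<dots> \<le> exp ((\<nu> + 1)\<^sup>2 / r - t)" using 3 by simp
        also have "\<dots> = C * exp (- t)" by (simp add: C_def exp_diff exp_minus field_simps)
        finally show ?thesis using True by (simp add: bessel_integrand_def C_def)
      qed (simp add: bessel_integrand_def)
    qed
  qed
qed

lemma bessel_K_antimono:
  assumes "0 < r" "r \<le> r'" "\<nu> \<ge> 0"
  shows "bessel_K \<nu> r' \<le> bessel_K \<nu> r"
  unfolding bessel_K_alt
proof (rule integral_mono)
  fix t show "bessel_integrand \<nu> r' t \<le> bessel_integrand \<nu> r t"
    unfolding bessel_integrand_def using assms
    by (intro mult_left_mono mult_right_mono) (auto simp: cosh_real_nonneg)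
qed (use assms in \<open>auto intro: integrable_bessel_integrand\<close>)

text \<open>The order of the singularity at 0. For \<open>t\<close> in the unit interval that ends at \<open>ln (1 / r)\<close>,
  the damping factor \<open>exp (- r cosh t)\<close> is at least \<open>exp (- 1)\<close> while \<open>cosh (\<nu> t)\<close> is comparable
  with \<open>r\<^bsup>-\<nu>\<^esup>\<close>.\<close>
lemma bessel_K_lower:
  assumes "0 < r" "r \<le> exp (-1)" "\<nu> \<ge> 0"
  shows "exp (- 1 - \<nu>) / 2 * r powr (- \<nu>) \<le> bessel_K \<nu> r"
proof -
  define a where "a = - ln r"
  have a: "a \<ge> 1" using assms ln_le_cancel_iff[of r "exp (-1)"] by (simp add: a_def)
  have r: "r = exp (- a)" using assms by (simp add: a_def)
  have "exp (- 1 - \<nu>) / 2 * r powr (- \<nu>) = (LINT t|lebesgue. exp (- 1 - \<nu>) / 2 * r powr (- \<nu>) * indicator {a-1<..<a} t)"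
    by simp
  also have "\<dots> \<le> bessel_K \<nu> r"
    unfolding bessel_K_alt
  proof (rule integral_mono)
    show "integrable lebesgue (bessel_integrand \<nu> r)" by (rule integrable_bessel_integrand) (use assms in auto)
    show "integrable lebesgue (\<lambda>t. exp (- 1 - \<nu>) / 2 * r powr (- \<nu>) * indicator {a-1<..<a} t)"
      by (intro integrable_mult_right integrable_real_indicator) auto
    fix t show "exp (- 1 - \<nu>) / 2 * r powr (- \<nu>) * indicator {a-1<..<a} t \<le> bessel_integrand \<nu> r t"
    proof (cases "t \<in> {a-1<..<a}")
      case True
      then have t: "0 < t" "a - 1 < t" "t < a" using a by auto
      have "cosh t \<le> exp t" using t by (simp add: cosh_field_def)
      then have "r * cosh t \<le> exp (-a) * exp a" using t unfolding r
        by (intro mult_left_mono) (auto intro: order_trans)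
      then have 1: "exp (- 1) \<le> exp (- r * cosh t)" by (simp add: exp_minus_inverse mult.commute)
      have "exp (\<nu> * (a - 1)) / 2 \<le> exp (\<nu> * t) / 2" using t assms
        by (simp add: mult_left_mono)
      also have "\<dots> \<le> cosh (\<nu> * t)" by (simp add: cosh_field_def)
      finally have 2: "exp (\<nu> * (a - 1)) / 2 \<le> cosh (\<nu> * t)" .
      have "exp (- 1 - \<nu>) / 2 * r powr (- \<nu>) = exp (-1) * (exp (\<nu> * (a - 1)) / 2)"
        using assms(1) unfolding powr_def a_def
        by (simp add: exp_add[symmetric] algebra_simps exp_minus[symmetric])
      also have "\<dots> \<le> exp (- r * cosh t) * cosh (\<nu> * t)" using 1 2 by (intro mult_mono) auto
      finally show ?thesis using True t by (simp add: bessel_integrand_def)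
    qed (auto simp: bessel_integrand_def indicator_def)
  qed
  finally show ?thesis .
qed

lemma bessel_K_pos:
  assumes "0 < r" "\<nu> \<ge> 0" shows "0 < bessel_K \<nu> r"
proof -
  have "0 \<le> bessel_K \<nu> r" unfolding bessel_K_alt
    by (intro Bochner_Integration.integral_nonneg) (auto simp: bessel_integrand_def)
  moreover have "bessel_K \<nu> r \<noteq> 0"
  proof
    assume 0: "bessel_K \<nu> r = 0"
    have "AE t in lebesgue. bessel_integrand \<nu> r t = 0"
      using integral_nonneg_eq_0_iff_AE[OF integrable_bessel_integrand[OF assms]] 0
      unfolding bessel_K_alt by (auto simp: bessel_integrand_def)
    then have "AE t in lebesgue. t \<notin> {0<..<1::real}"
      by eventually_elim (auto simp: bessel_integrand_def)
    then have "emeasure lebesgue {0<..<1::real} = 0"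
      by (subst (asm) AE_iff_measurable[of "{0<..<1}"]) auto
    then show False by simp
  qed
  ultimately show ?thesis by simp
qed

text \<open>The radial kernel of \<open>(- \<Delta> + m\<^sup>2)\<^sup>s\<close>, up to its constant, when \<open>\<nu> = N / 2 + s\<close>.\<close>
definition bessel_kernel :: "real \<Rightarrow> real \<Rightarrow> real \<Rightarrow> real" where
  "bessel_kernel \<nu> m r = bessel_K \<nu> (m * r) / r powr \<nu>"

lemma bessel_kernel_pos:
  assumes "0 < m" "0 \<le> \<nu>" "0 < r"
  shows "0 < bessel_kernel \<nu> m r"
  unfolding bessel_kernel_def using assms by (intro divide_pos_pos bessel_K_pos) auto

lemma bessel_kernel_strict_antimono:
  assumes "0 < m" "0 < \<nu>" "0 < r" "r < r'"
  shows "bessel_kernel \<nu> m r' < bessel_kernel \<nu> m r"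
proof -
  have "r powr \<nu> < r' powr \<nu>" using assms by (intro powr_less_mono2) auto
  moreover have "bessel_K \<nu> (m * r') \<le> bessel_K \<nu> (m * r)"
    using assms by (intro bessel_K_antimono) auto
  moreover have "0 < bessel_K \<nu> (m * r')" using assms by (intro bessel_K_pos) auto
  moreover have "0 < r powr \<nu>" using assms by simp
  ultimately show ?thesis
    unfolding bessel_kernel_def by (intro frac_less2) auto
qed

text \<open>The kernel is bounded below by a multiple of \<open>d\<^bsup>-2\<nu>\<^esup>\<close>, which is not integrable near the
  origin of three-dimensional space when \<open>2 \<nu> > 3\<close>. This is what makes narrow regions favourable
  in the moving plane argument.\<close>
lemma bessel_kernel_blowup:
  assumes m: "0 < m" and \<nu>: "3 / 2 < \<nu>"
  shows "filterlim (\<lambda>d. d ^ 3 * bessel_kernel \<nu> m (3 * d)) at_top (at_right 0)"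
proof -
  define c where "c = exp (- 1 - \<nu>) / 2 * (3 * m) powr (- \<nu>) * 3 powr (- \<nu>)"
  have c: "0 < c" using m by (simp add: c_def)
  have "filterlim (\<lambda>d. d powr (3 - 2 * \<nu>)) at_top (at_right (0::real))"
  proof -
    have "filterlim (\<lambda>d. - ln d) at_top (at_right (0::real))"
      using ln_at_0 by (simp add: filterlim_uminus_at_bot)
    then have "filterlim (\<lambda>d. (2 * \<nu> - 3) * - ln d) at_top (at_right (0::real))"
      using \<nu> by (intro filterlim_tendsto_pos_mult_at_top[OF tendsto_const]) auto
    then have "filterlim (\<lambda>d. exp ((2 * \<nu> - 3) * - ln d)) at_top (at_right (0::real))"
      by (rule filterlim_compose[OF exp_at_top])
    moreover have "eventually (\<lambda>d::real. exp ((2 * \<nu> - 3) * - ln d) = d powr (3 - 2 * \<nu>)) (at_right 0)"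
      using eventually_at_right_less[of "0::real"]
      by eventually_elim (simp add: powr_def algebra_simps)
    ultimately show ?thesis using filterlim_cong[OF refl refl] by fast
  qed
  then have "filterlim (\<lambda>d. c * d powr (3 - 2 * \<nu>)) at_top (at_right (0::real))"
    by (rule filterlim_tendsto_pos_mult_at_top[OF tendsto_const c])
  moreover have "eventually (\<lambda>d. c * d powr (3 - 2 * \<nu>) \<le> d ^ 3 * bessel_kernel \<nu> m (3 * d)) (at_right 0)"
    unfolding eventually_at_right_field
  proof (intro exI[of _ "exp (-1) / (3 * m)"] conjI allI impI)
    show "0 < exp (-1) / (3 * m)" using m by simp
    fix d :: real assume d: "0 < d" "d < exp (-1) / (3 * m)"
    have "d ^ 3 * bessel_kernel \<nu> m (3 * d) = d ^ 3 * ((3 * d) powr (- \<nu>) * bessel_K \<nu> (m * (3 * d)))"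
      using d by (simp add: bessel_kernel_def powr_minus field_simps)
    also have "\<dots> \<ge> d ^ 3 * ((3 * d) powr (- \<nu>) * (exp (- 1 - \<nu>) / 2 * (m * (3 * d)) powr (- \<nu>)))"
      using d m \<nu> by (intro mult_left_mono bessel_K_lower) (auto simp: field_simps)
    also have "d ^ 3 * ((3 * d) powr (- \<nu>) * (exp (- 1 - \<nu>) / 2 * (m * (3 * d)) powr (- \<nu>)))
        = c * (d powr 3 * d powr (- \<nu>) * d powr (- \<nu>))"
      using d m by (simp add: c_def powr_mult)
    also have "d powr 3 * d powr (- \<nu>) * d powr (- \<nu>) = d powr (3 - 2 * \<nu>)"
      by (simp add: powr_add[symmetric])
    finally show "c * d powr (3 - 2 * \<nu>) \<le> d ^ 3 * bessel_kernel \<nu> m (3 * d)" .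
  qed
  ultimately show ?thesis by (rule filterlim_at_top_mono)
qed

section \<open>Potentials of the solution\<close>

text \<open>Only the linear growth in \<open>R\<close> matters. It comes from the dyadic shells
  \<open>R / 2\<^bsup>k+1\<^esup> \<le> norm (x - y) < R / 2\<^sup>k\<close>, on which the integrand is at most \<open>4\<^bsup>k+1\<^esup> / R\<^sup>2\<close>:
  bounding each shell by its enclosing ball gives a geometric series of ratio \<open>8\<inverse> \<cdot> 4 = 1 / 2\<close>.\<close>
lemma nn_integral_inverse_sq_ball:
  fixes x :: "real^3" and R :: real
  assumes R: "R > 0"
  shows "(\<integral>\<^sup>+y. ennreal (indicator (ball x R) y / (norm (x - y))\<^sup>2) \<partial>lebesgue) \<le> ennreal (32 / 3 * pi * R)"
proof -
  define a where "a k = 4 ^ (k+1) / R\<^sup>2" for k :: nat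
  define B where "B k = ball x (R / 2 ^ k)" for k :: nat
  have a: "0 \<le> a k" for k by (simp add: a_def)
  have "(\<integral>\<^sup>+y. ennreal (indicator (ball x R) y / (norm (x - y))\<^sup>2) \<partial>lebesgue)
      \<le> (\<integral>\<^sup>+y. (\<Sum>k. ennreal (a k) * indicator (B k) y) \<partial>lebesgue)"
  proof (rule nn_integral_mono)
    fix y
    show "ennreal (indicator (ball x R) y / (norm (x - y))\<^sup>2) \<le> (\<Sum>k. ennreal (a k) * indicator (B k) y)"
    proof (cases "y \<noteq> x \<and> y \<in> ball x R")
      case True
      define r where "r = norm (x - y)"
      have r: "0 < r" "r < R" using True by (auto simp: r_def dist_norm)
      obtain n0 where "(1/2) ^ n0 < r / R"
        using real_arch_pow_inv[of "r / R" "1/2"] r by auto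
      then have ex: "\<exists>n. R / 2 ^ n \<le> r" using r R
        by (intro exI[of _ n0]) (simp add: field_simps power_one_over)
      define n where "n = (LEAST n. R / 2 ^ n \<le> r)"
      have n: "R / 2 ^ n \<le> r" unfolding n_def using ex by (rule LeastI_ex)
      have "n \<noteq> 0" using n r by (intro notI) simp
      then obtain k where k: "n = Suc k" by (cases n) auto
      have "\<not> R / 2 ^ k \<le> r" using not_less_Least[of k "\<lambda>n. R / 2 ^ n \<le> r"] k n_def by auto
      then have in_B: "y \<in> B k" by (simp add: B_def dist_norm r_def)
      have "R \<le> r * 2 ^ (k+1)" using n R by (simp add: k field_simps)
      then have "R\<^sup>2 \<le> (r * 2 ^ (k+1))\<^sup>2" using R by (intro power_mono) auto
      also have "\<dots> = r\<^sup>2 * 4 ^ (k+1)" by (simp add: power_mult_distrib power_even_eq[symmetric] power2_eq_square flip: power_mult_distrib)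
      finally have "1 / r\<^sup>2 \<le> a k" using r R by (simp add: a_def field_simps)
      then have "ennreal (indicator (ball x R) y / (norm (x - y))\<^sup>2) \<le> ennreal (a k) * indicator (B k) y"
        using True in_B by (simp add: r_def ennreal_leI)
      also have "\<dots> = sum (\<lambda>k. ennreal (a k) * indicator (B k) y) {k}"
        by (simp only: sum.insert sum.empty finite.emptyI empty_iff add_0_right not_False_eq_True)
      also have "\<dots> \<le> (\<Sum>k. ennreal (a k) * indicator (B k) y)"
        by (rule sum_le_suminf) auto
      finally show ?thesis .
    qed (auto)
  qed
  also have "\<dots> = (\<Sum>k. \<integral>\<^sup>+y. ennreal (a k) * indicator (B k) y \<partial>lebesgue)"
    by (intro nn_integral_suminf borel_measurable_times_ennreal borel_measurable_indicator) (auto simp: B_def)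
  also have "\<dots> = (\<Sum>k. ennreal (16 / 3 * pi * R * (1/2) ^ k))"
  proof (intro suminf_cong)
    fix k
    have "(\<integral>\<^sup>+y. ennreal (a k) * indicator (B k) y \<partial>lebesgue) = ennreal (a k) * emeasure lebesgue (B k)"
      by (subst nn_integral_cmult_indicator) (auto simp: B_def)
    also have "\<dots> = ennreal (a k * (4 / 3 * pi * (R / 2 ^ k) ^ 3))"
    proof -
      have "emeasure lebesgue (B k) = ennreal (4 / 3 * pi * (R / 2 ^ k) ^ 3)"
        unfolding B_def using R by (simp add: emeasure_ball unit_ball_vol_3)
      then show ?thesis using R a by (simp only: ennreal_mult'[OF a])
    qed
    also have "a k * (4 / 3 * pi * (R / 2 ^ k) ^ 3) = 16 / 3 * pi * R * (1/2) ^ k"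
    proof -
      have "(4::real) ^ k = 2 ^ k * 2 ^ k" by (simp flip: power_mult_distrib)
      then show ?thesis using R
        by (simp add: a_def field_simps power2_eq_square power3_eq_cube power_one_over)
    qed
    finally show "(\<integral>\<^sup>+y. ennreal (a k) * indicator (B k) y \<partial>lebesgue) = ennreal (16 / 3 * pi * R * (1/2) ^ k)" .
  qed
  also have "\<dots> = ennreal (32 / 3 * pi * R)"
  proof (rule suminf_ennreal_eq)
    show "(\<lambda>k. 16 / 3 * pi * R * (1/2) ^ k) sums (32 / 3 * pi * R)"
      using sums_mult[OF geometric_sums[of "1/2::real"], of "16 / 3 * pi * R"] by (simp add: mult.assoc)
  qed (use R in auto)
  finally show ?thesis .
qed

text \<open>Of the kernel, the method uses the sign, the strict monotonicity and the strength of the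
  singularity. The argument \<open>3 * d\<close> in \<open>j_blowup\<close> is a bound for the distances that occur in
  \<open>negative_minimum_estimate\<close>.\<close>
locale choquard_profile =
  fixes u :: "real^3 \<Rightarrow> real" and j :: "real \<Rightarrow> real" and A \<mu> :: real
  assumes A_pos: "0 < A" and mu_pos: "0 < \<mu>"
    and j_pos: "\<And>r. 0 < r \<Longrightarrow> 0 < j r"
    and j_strict: "\<And>r r'. 0 < r \<Longrightarrow> r < r' \<Longrightarrow> j r' < j r"
    and j_blowup: "filterlim (\<lambda>d. d ^ 3 * j (3 * d)) at_top (at_right 0)"
    and u_cont: "continuous_on UNIV u"
    and u_nonneg: "\<And>x. 0 \<le> u x"
    and u_decay: "((\<lambda>x. norm x * u x) \<longlongrightarrow> 0) at_infinity"
    and u_integrable: "integrable lebesgue (\<lambda>x. u x / (norm x)\<^sup>2)"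
    and hartree_integrable: "\<And>x. integrable lebesgue (\<lambda>y. (u y)\<^sup>2 / norm (x - y))"
    and pv: "\<And>x. pv_integrable x (\<lambda>y. (u x - u y) * j (norm (x - y)))"
    and equation: "\<And>x. A * pv_integral x (\<lambda>y. (u x - u y) * j (norm (x - y))) + \<mu> * u x
      = hartree_potential u x * u x"
begin

lemma u_small:
  assumes "\<epsilon> > 0"
  obtains R where "R > 0" "\<And>x. R \<le> norm x \<Longrightarrow> norm x * u x \<le> \<epsilon>"
proof -
  have "eventually (\<lambda>x. dist (norm x * u x) 0 < \<epsilon>) at_infinity"
    using tendstoD[OF u_decay assms] .
  then obtain b where b: "\<And>x. b \<le> norm x \<Longrightarrow> dist (norm x * u x) 0 < \<epsilon>"
    unfolding eventually_at_infinity by auto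
  show thesis
  proof (rule that[of "max b 1"])
    fix x :: "real^3" assume "max b 1 \<le> norm x"
    then show "norm x * u x \<le> \<epsilon>" using b[of x] by (simp add: dist_real_def)
  qed simp
qed

lemma u_bounded:
  obtains B where "B > 0" "\<And>x. u x \<le> B" "\<And>x. norm x * u x \<le> B"
proof -
  obtain R where R: "R > 0" "\<And>x. R \<le> norm x \<Longrightarrow> norm x * u x \<le> 1" by (rule u_small[OF zero_less_one]) blast
  have "compact (u ` cball 0 (max R 1))"
    by (intro compact_continuous_image continuous_on_subset[OF u_cont]) auto
  then have "bounded (u ` cball 0 (max R 1))" by (rule compact_imp_bounded)
  then obtain b where "\<forall>y \<in> u ` cball 0 (max R 1). norm y \<le> b"
    unfolding bounded_iff by blast
  then have b: "norm (u x) \<le> b" if "x \<in> cball 0 (max R 1)" for x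
    using that by blast
  have b0: "0 \<le> b" using order_trans[OF norm_ge_zero b[of 0]] by simp
  have ub: "u x \<le> b + 1 \<and> norm x * u x \<le> b * max R 1 + 1" for x
  proof (cases "norm x \<le> max R 1")
    case True
    then have "u x \<le> b" using b[of x] by auto
    then have "norm x * u x \<le> max R 1 * b" using True u_nonneg by (intro mult_mono) auto
    then show ?thesis using \<open>u x \<le> b\<close> by (simp add: mult.commute)
  next
    case False
    then have 1: "norm x * u x \<le> 1" using R(2)[of x] by auto
    have "1 * u x \<le> norm x * u x" using False u_nonneg[of x] by (intro mult_right_mono) auto
    moreover have "0 \<le> b * max R 1" using b0 by simp
    ultimately show ?thesis using 1 b0 by linarith
  qed
  show thesis
  proof (rule that[of "b * max R 1 + b + 1"])
    have "0 \<le> b * max R 1" using b0 by simp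
    then show "0 < b * max R 1 + b + 1" using b0 by linarith
    fix x :: "real^3"
    show "u x \<le> b * max R 1 + b + 1" "norm x * u x \<le> b * max R 1 + b + 1"
      using \<open>0 \<le> b * max R 1\<close> ub[of x] b0 by linarith+
  qed
qed

lemma AE_neq_point: "AE y in lebesgue. y \<noteq> (a::real^3)"
  using AE_completion[OF AE_lborel_singleton] .

lemma u_measurable [measurable]: "u \<in> borel_measurable lebesgue"
  by (rule measurable_completion) (simp add: borel_measurable_continuous_onI u_cont)

lemma norm_diff_measurable [measurable]:
  "(\<lambda>y::real^3. norm (x - y)) \<in> borel_measurable lebesgue"
  by (rule measurable_completion) measurable

text \<open>The Riesz potential of \<open>u\<close> of order 1, without its normalising constant.\<close>
definition riesz_potential :: "real^3 \<Rightarrow> real" where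
  "riesz_potential x = (LINT y|lebesgue. u y / (norm (x - y))\<^sup>2)"

lemma riesz_potential_nonneg: "0 \<le> riesz_potential x"
  unfolding riesz_potential_def by (intro Bochner_Integration.integral_nonneg) (simp add: u_nonneg)

text \<open>Where \<open>norm (x - y) \<ge> norm y / 2\<close> the weight \<open>1 / norm (x - y)\<^sup>2\<close> is controlled by
  \<open>1 / (norm y)\<^sup>2\<close>, hence by the integrability of \<open>u / (norm y)\<^sup>2\<close>. The remaining \<open>y\<close> lie within
  \<open>norm x\<close> of \<open>x\<close>, and there \<open>u y \<le> B / norm y\<close> is of order \<open>1 / norm x\<close>, which compensates the
  linear growth in \<open>nn_integral_inverse_sq_ball\<close>.\<close>
lemma riesz_potential_nn_bounded:
  obtains M where "M \<ge> 0"
    "\<And>x. (\<integral>\<^sup>+y. ennreal (u y / (norm (x - y))\<^sup>2) \<partial>lebesgue) \<le> ennreal M"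
proof -
  define I where "I = (LINT y|lebesgue. u y / (norm y)\<^sup>2)"
  have I0: "0 \<le> I" unfolding I_def by (intro Bochner_Integration.integral_nonneg) (simp add: u_nonneg)
  have I: "(\<integral>\<^sup>+y. ennreal (u y / (norm y)\<^sup>2) \<partial>lebesgue) = ennreal I"
    unfolding I_def by (rule nn_integral_eq_integral[OF u_integrable]) (simp add: u_nonneg)
  obtain B where B: "B > 0" "\<And>x. u x \<le> B" "\<And>x. norm x * u x \<le> B" using u_bounded by blast
  define M where "M = 4 * I + 16 * pi * B"
  have "(\<integral>\<^sup>+y. ennreal (u y / (norm (x - y))\<^sup>2) \<partial>lebesgue) \<le> ennreal M" for x
  proof (cases "x = 0")
    case True
    have "I \<le> M" using I0 B by (simp add: M_def)
    with True show ?thesis using I by (simp add: ennreal_leI)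
  next
    case False
    define k where "k = 3 * B / (2 * norm x)"
    have k: "k \<ge> 0" using B by (simp add: k_def)
    have "(\<integral>\<^sup>+y. ennreal (u y / (norm (x - y))\<^sup>2) \<partial>lebesgue)
      \<le> (\<integral>\<^sup>+y. ennreal 4 * ennreal (u y / (norm y)\<^sup>2)
            + ennreal k * ennreal (indicator (ball x (norm x)) y / (norm (x - y))\<^sup>2) \<partial>lebesgue)"
    proof (rule nn_integral_mono_AE, use AE_neq_point[of 0] in eventually_elim)
      case (elim y)
      have "u y / (norm (x - y))\<^sup>2 \<le> 4 * (u y / (norm y)\<^sup>2)
            + k * (indicator (ball x (norm x)) y / (norm (x - y))\<^sup>2)"
      proof (cases "norm (x - y) \<ge> norm y / 2")
        case True
        then have "(norm y / 2)\<^sup>2 \<le> (norm (x - y))\<^sup>2" by (intro power_mono) auto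
        then have "u y / (norm (x - y))\<^sup>2 \<le> u y / (norm y / 2)\<^sup>2"
          using elim u_nonneg[of y] by (intro divide_left_mono) (auto intro!: mult_pos_pos simp: order_less_le_trans[of 0 "(norm y / 2)\<^sup>2"])
        also have "\<dots> = 4 * (u y / (norm y)\<^sup>2)" by (simp add: power_divide)
        also have "\<dots> \<le> 4 * (u y / (norm y)\<^sup>2)
            + k * (indicator (ball x (norm x)) y / (norm (x - y))\<^sup>2)" using k by simp
        finally show ?thesis .
      next
        case F: False
        have t1: "norm y \<le> norm x + norm (x - y)" by norm
        have t2: "norm x \<le> norm y + norm (x - y)" by norm
        have "norm (x - y) < norm x" using F t1 by simp
        then have in_ball: "y \<in> ball x (norm x)" by (simp add: dist_norm)
        have "2 * norm x \<le> 3 * norm y" using F t2 by simp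
        then have "u y * (2 * norm x) \<le> u y * (3 * norm y)" using u_nonneg by (rule mult_left_mono)
        also have "\<dots> \<le> 3 * B" using B(3)[of y] by (simp add: mult.commute)
        finally have "u y \<le> k" using False by (simp add: k_def field_simps)
        then have "u y / (norm (x - y))\<^sup>2 \<le> k * (indicator (ball x (norm x)) y / (norm (x - y))\<^sup>2)"
          using in_ball by (simp add: divide_right_mono)
        then show ?thesis using u_nonneg[of y] by (simp add: add_increasing)
      qed
      then have "ennreal (u y / (norm (x - y))\<^sup>2) \<le> ennreal (4 * (u y / (norm y)\<^sup>2)
            + k * (indicator (ball x (norm x)) y / (norm (x - y))\<^sup>2))" by (rule ennreal_leI)
      also have "\<dots> = ennreal 4 * ennreal (u y / (norm y)\<^sup>2)
            + ennreal k * ennreal (indicator (ball x (norm x)) y / (norm (x - y))\<^sup>2)"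
        using k u_nonneg[of y]
        by (subst ennreal_plus) (simp_all only: ennreal_mult'[symmetric] zero_le_numeral divide_nonneg_nonneg
            mult_nonneg_nonneg zero_le_power2 indicator_pos_le)
      finally show ?case .
    qed
    also have "\<dots> = ennreal 4 * (\<integral>\<^sup>+y. ennreal (u y / (norm y)\<^sup>2) \<partial>lebesgue)
       + ennreal k * (\<integral>\<^sup>+y. ennreal (indicator (ball x (norm x)) y / (norm (x - y))\<^sup>2) \<partial>lebesgue)"
    proof -
      have [measurable]: "(norm :: real^3 \<Rightarrow> real) \<in> borel_measurable lebesgue"
        using norm_diff_measurable[of 0] by simp
      have [measurable]: "ball x (norm x) \<in> sets lebesgue" by simp
      show ?thesis by (subst nn_integral_add) (simp_all add: nn_integral_cmult)
    qed
    also have "\<dots> \<le> ennreal 4 * ennreal I + ennreal k * ennreal (32 / 3 * pi * norm x)"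
      unfolding I using False by (intro add_left_mono mult_left_mono nn_integral_inverse_sq_ball) auto
    also have "\<dots> = ennreal (4 * I + k * (32 / 3 * pi * norm x))"
      using k I0 by (subst ennreal_plus) (simp_all only: ennreal_mult'[symmetric] zero_le_numeral
            mult_nonneg_nonneg divide_nonneg_nonneg norm_ge_zero pi_ge_zero)
    also have "4 * I + k * (32 / 3 * pi * norm x) = M"
      using False by (simp add: k_def M_def field_simps)
    finally show ?thesis .
  qed
  moreover have "M \<ge> 0" using I0 B by (simp add: M_def)
  ultimately show thesis using that by blast
qed

lemma riesz_potential_integrable: "integrable lebesgue (\<lambda>y. u y / (norm (x - y))\<^sup>2)"
proof -
  obtain M where M: "\<And>x. (\<integral>\<^sup>+y. ennreal (u y / (norm (x - y))\<^sup>2) \<partial>lebesgue) \<le> ennreal M"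
    using riesz_potential_nn_bounded by blast
  show ?thesis
  proof (rule integrableI_nonneg)
    show "(\<integral>\<^sup>+y. ennreal (u y / (norm (x - y))\<^sup>2) \<partial>lebesgue) < \<infinity>"
      using M[of x] by (simp add: order_le_less_trans)
  qed (auto simp: u_nonneg)
qed

lemma riesz_potential_bounded:
  obtains M where "M \<ge> 0" "\<And>x. riesz_potential x \<le> M"
proof -
  obtain M where M: "M \<ge> 0" "\<And>x. (\<integral>\<^sup>+y. ennreal (u y / (norm (x - y))\<^sup>2) \<partial>lebesgue) \<le> ennreal M"
    using riesz_potential_nn_bounded by blast
  have "riesz_potential x \<le> M" for x
    using M(2)[of x] M(1) nn_integral_eq_integral[OF riesz_potential_integrable[of x]]
    by (simp add: u_nonneg riesz_potential_def)
  with M(1) show thesis using that by blast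
qed

text \<open>Outside the ball of radius \<open>R\<close> one factor \<open>u y\<close> is replaced by \<open>K / norm y\<close>, and
  \<open>1 / (a b) \<le> (1 / a\<^sup>2 + 1 / b\<^sup>2) / 2\<close> splits the kernel into two Riesz potentials. Inside,
  \<open>norm (x - y) \<ge> norm x / 2\<close>. With \<open>R = 0\<close> this is a bound for every \<open>x\<close>; with \<open>K\<close> small it shows
  decay at infinity.\<close>
lemma hartree_bound:
  assumes R: "0 \<le> R" "2 * R \<le> norm x" and B: "\<And>y. u y \<le> B"
    and K: "0 \<le> K" "\<And>y. R \<le> norm y \<Longrightarrow> norm y * u y \<le> K"
  shows "hartree_potential u x \<le> K / 2 * (riesz_potential 0 + riesz_potential x) + 2 * B\<^sup>2 / norm x * measure lebesgue (ball (0::real^3) R)"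
proof -
  define F where "F y = K / 2 * (u y / (norm (0 - y))\<^sup>2 + u y / (norm (x - y))\<^sup>2)
      + 2 * B\<^sup>2 / norm x * indicator (ball 0 R) y" for y
  have intF: "integrable lebesgue F" unfolding F_def
    by (intro Bochner_Integration.integrable_add integrable_mult_right riesz_potential_integrable integrable_real_indicator)
       (auto simp: emeasure_ball R)
  have "hartree_potential u x \<le> (LINT y|lebesgue. F y)"
    unfolding hartree_potential_def
  \<comment> \<open>The points 0 and \<open>x\<close> are exceptional because division by zero gives 0.\<close>
  proof (rule integral_mono_AE[OF hartree_integrable intF], use AE_neq_point[of 0] AE_neq_point[of x] in eventually_elim)
    case (elim y)
    define a b where "a = norm y" and "b = norm (x - y)"
    have ab: "0 < a" "0 < b" using elim by (auto simp: a_def b_def)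
    show ?case
    proof (cases "R \<le> norm y")
      case True
      have "(u y)\<^sup>2 / b = (a * u y) * (u y / (a * b))"
        using ab by (simp add: field_simps power2_eq_square)
      also have "\<dots> \<le> K * (u y / (a * b))"
        using K(2)[OF True] ab u_nonneg by (intro mult_right_mono) (auto simp: a_def)
      also have "u y / (a * b) \<le> u y * ((1 / a\<^sup>2 + 1 / b\<^sup>2) / 2)"
      proof -
        have "0 \<le> (1 / a - 1 / b)\<^sup>2" by simp
        then have "1 / (a * b) \<le> (1 / a\<^sup>2 + 1 / b\<^sup>2) / 2"
          by (simp add: power2_diff power_divide)
        then show ?thesis using mult_left_mono[OF _ u_nonneg[of y]] by fastforce
      qed
      finally have "(u y)\<^sup>2 / b \<le> K * (u y * ((1 / a\<^sup>2 + 1 / b\<^sup>2) / 2))"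
        using K(1) by (simp add: mult_left_mono)
      also have "\<dots> = K / 2 * (u y / a\<^sup>2 + u y / b\<^sup>2)" by (simp add: field_simps)
      finally have "(u y)\<^sup>2 / b \<le> K / 2 * (u y / a\<^sup>2 + u y / b\<^sup>2)" .
      then show ?thesis unfolding F_def a_def b_def by (auto intro: add_increasing2)
    next
      case False
      have "norm x \<le> norm y + norm (x - y)" by norm
      then have b: "norm x / 2 \<le> b" using False R by (simp add: b_def)
      have x0: "0 < norm x" using False R by (smt (verit) norm_ge_zero)
      have "(u y)\<^sup>2 / b \<le> B\<^sup>2 / (norm x / 2)"
        using b x0 B[of y] u_nonneg[of y] by (intro frac_le power_mono) auto
      then show ?thesis using False u_nonneg[of y] K(1) unfolding F_def b_def
        by (auto intro!: add_increasing simp: mult.commute)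
    qed
  qed
  also have "(LINT y|lebesgue. F y) = K / 2 * (riesz_potential 0 + riesz_potential x) + 2 * B\<^sup>2 / norm x * measure lebesgue (ball (0::real^3) R)"
    unfolding F_def riesz_potential_def
    by (subst Bochner_Integration.integral_add;
        (intro Bochner_Integration.integrable_add integrable_mult_right riesz_potential_integrable integrable_real_indicator; auto simp: emeasure_ball R; fail)?)
       (simp add: Bochner_Integration.integral_add riesz_potential_integrable integral_mult_right_zero riesz_potential_integrable[of 0, simplified])
  finally show ?thesis .
qed

lemma hartree_bounded:
  obtains H where "\<And>x. hartree_potential u x \<le> H"
proof -
  obtain B where B: "B > 0" "\<And>x. u x \<le> B" "\<And>x. norm x * u x \<le> B" using u_bounded by blast
  obtain M where M: "M \<ge> 0" "\<And>x. riesz_potential x \<le> M" using riesz_potential_bounded by blast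
  have "hartree_potential u x \<le> B * M" for x
  proof -
    have "hartree_potential u x \<le> B / 2 * (riesz_potential 0 + riesz_potential x)"
      using hartree_bound[of 0 x B B] B by simp
    also have "\<dots> \<le> B / 2 * (M + M)" using M B by (intro mult_left_mono add_mono) auto
    finally show ?thesis by simp
  qed
  then show thesis by (rule that)
qed

lemma hartree_small:
  assumes "\<epsilon> > 0"
  obtains R where "R > 0" "\<And>x. R \<le> norm x \<Longrightarrow> hartree_potential u x \<le> \<epsilon>"
proof -
  obtain B where B: "B > 0" "\<And>x. u x \<le> B" "\<And>x. norm x * u x \<le> B" using u_bounded by blast
  obtain M where M: "M \<ge> 0" "\<And>x. riesz_potential x \<le> M" using riesz_potential_bounded by blast
  define K where "K = \<epsilon> / (2 * (M + 1))"
  have K: "K > 0" using assms M by (simp add: K_def)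
  obtain R where R: "R > 0" "\<And>x. R \<le> norm x \<Longrightarrow> norm x * u x \<le> K" by (rule u_small[OF K]) blast
  define V where "V = measure lebesgue (ball (0::real^3) R)"
  define R' where "R' = max (2 * R) (4 * B\<^sup>2 * V / \<epsilon>)"
  have "hartree_potential u x \<le> \<epsilon>" if x: "R' \<le> norm x" for x
  proof -
    have xR: "2 * R \<le> norm x" "4 * B\<^sup>2 * V / \<epsilon> \<le> norm x" using x by (auto simp: R'_def)
    have x0: "0 < norm x" using xR R by linarith
    have "hartree_potential u x \<le> K / 2 * (riesz_potential 0 + riesz_potential x) + 2 * B\<^sup>2 / norm x * V"
      unfolding V_def using R K B xR by (intro hartree_bound) auto
    also have "K / 2 * (riesz_potential 0 + riesz_potential x) \<le> K / 2 * ((M + 1) + (M + 1))"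
      using M K by (intro mult_left_mono add_mono) (auto intro: add_increasing2)
    also have "\<dots> = \<epsilon> / 2" using M by (simp add: K_def field_simps)
    also have "2 * B\<^sup>2 / norm x * V \<le> \<epsilon> / 2" using xR(2) x0 assms by (simp add: field_simps)
    finally show ?thesis by simp
  qed
  moreover have "R' > 0" using R by (simp add: R'_def)
  ultimately show thesis using that by blast
qed

text \<open>The quantity \<open>hartree_potential u x + 4 u x d riesz_potential x\<close> is the zero order
  coefficient that \<open>negative_minimum_estimate\<close> compares with \<open>\<mu>\<close>, for a point \<open>x\<close> at distance \<open>d\<close>
  from a plane. The bound \<open>d \<le> L + norm x\<close> holds for all planes up to position \<open>L\<close>, and
  \<open>u x = o(1 / norm x)\<close> absorbs its growth.\<close>
lemma coefficient_bounds:
  assumes L: "0 \<le> L"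
  obtains R Q where "R > 0"
    "\<And>x d. d \<le> L + norm x \<Longrightarrow> 0 \<le> d \<Longrightarrow> hartree_potential u x + 4 * u x * d * riesz_potential x \<le> Q"
    "\<And>x d. R \<le> norm x \<Longrightarrow> 0 \<le> d \<Longrightarrow> d \<le> L + norm x \<Longrightarrow> hartree_potential u x + 4 * u x * d * riesz_potential x < \<mu>"
proof -
  obtain B where B: "B > 0" "\<And>x. u x \<le> B" "\<And>x. norm x * u x \<le> B" using u_bounded by blast
  obtain M where M: "M \<ge> 0" "\<And>x. riesz_potential x \<le> M" using riesz_potential_bounded by blast
  obtain H where H: "\<And>x. hartree_potential u x \<le> H" using hartree_bounded by blast
  have est: "4 * u x * d * riesz_potential x \<le> 4 * (L * u x + norm x * u x) * M"
    if "0 \<le> d" "d \<le> L + norm x" for x d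
  proof -
    have "u x * d \<le> u x * (L + norm x)" using that u_nonneg by (intro mult_left_mono) auto
    then have "u x * d * riesz_potential x \<le> (u x * (L + norm x)) * M"
      by (rule mult_mono) (use M riesz_potential_nonneg[of x] u_nonneg[of x] L in auto)
    then show ?thesis by (simp add: algebra_simps)
  qed
  define c where "c = M + 1"
  have c: "c > 0" using M by (simp add: c_def)
  define K where "K = \<mu> / (16 * c)"
  have K: "K > 0" using mu_pos c by (simp add: K_def)
  obtain R1 where R1: "R1 > 0" "\<And>x. R1 \<le> norm x \<Longrightarrow> norm x * u x \<le> K" by (rule u_small[OF K]) blast
  obtain R2 where R2: "R2 > 0" "\<And>x. R2 \<le> norm x \<Longrightarrow> hartree_potential u x \<le> \<mu> / 4"
    using hartree_small[of "\<mu> / 4"] mu_pos by (metis zero_less_divide_iff zero_less_numeral)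
  define R where "R = max (max R1 R2) L"
  have small: "hartree_potential u x + 4 * u x * d * riesz_potential x < \<mu>"
    if "R \<le> norm x" "0 \<le> d" "d \<le> L + norm x" for x d
  proof -
    have "L * u x \<le> norm x * u x" using that u_nonneg by (intro mult_right_mono) (auto simp: R_def)
    then have "4 * (L * u x + norm x * u x) * M \<le> 4 * (K + K) * c"
      using R1(2)[of x] that M u_nonneg[of x] L K by (intro mult_mono) (auto simp: R_def c_def)
    also have "\<dots> = \<mu> / 2" using c by (simp add: K_def)
    finally show ?thesis using est[of d x] R2(2)[of x] that mu_pos by (auto simp: R_def)
  qed
  have "hartree_potential u x + 4 * u x * d * riesz_potential x \<le> H + 4 * (L * B + B) * M"
    if "0 \<le> d" "d \<le> L + norm x" for x d
  proof -
    have "4 * (L * u x + norm x * u x) * M \<le> 4 * (L * B + B) * M"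
      using B(2,3)[of x] L M by (intro mult_right_mono mult_left_mono add_mono) auto
    then show ?thesis using est[OF that] H[of x] by linarith
  qed
  moreover have "R > 0" using R1 by (simp add: R_def)
  ultimately show thesis using that small by blast
qed

section \<open>The equation for the reflected difference\<close>

lemma j_antimono: "0 < r \<Longrightarrow> r \<le> r' \<Longrightarrow> j r' \<le> j r"
  using j_strict[of r r'] by (cases "r = r'") auto

lemma u_continuous: "continuous_on S f \<Longrightarrow> continuous_on S (\<lambda>z. u (f z))"
  using continuous_on_compose2[OF u_cont, of S f] by auto

text \<open>The function \<open>w\<close> of the moving plane method.\<close>
definition reflection_gap :: "real^3 \<Rightarrow> real \<Rightarrow> real^3 \<Rightarrow> real" where
  "reflection_gap e l x = u (mirror e l x) - u x"

lemma reflection_gap_mirror: "norm e = 1 \<Longrightarrow> reflection_gap e l (mirror e l x) = - reflection_gap e l x"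
  by (simp add: reflection_gap_def)

text \<open>Fold the integral of \<open>(u y)\<^sup>2 (1 / norm (x - y) - 1 / norm (R x - y))\<close>, with \<open>R\<close> the
  reflection and \<open>w\<close> the gap. On the half space the kernel difference is nonnegative, so only
  points with \<open>w y < 0\<close> contribute positively; for them \<open>(u y)\<^sup>2 - (u (R y))\<^sup>2 \<le> 2 k u y\<close>, and the
  kernel difference is at most \<open>norm (x - R x) / (norm (x - y))\<^sup>2\<close>.\<close>
lemma hartree_potential_gap:
  assumes e: "norm e = 1" and x: "e \<bullet> x < l" and k: "0 \<le> k"
    and gap: "\<And>y. e \<bullet> y \<le> l \<Longrightarrow> - k \<le> reflection_gap e l y"
  shows "hartree_potential u x - hartree_potential u (mirror e l x) \<le> 4 * k * (l - e \<bullet> x) * riesz_potential x"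
proof -
  define R where "R = mirror e l"
  define D where "D = 2 * (l - e \<bullet> x)"
  have D: "norm (x - R x) = D" "D > 0" using x norm_self_diff_mirror[OF e, of x l] by (auto simp: D_def R_def)
  define f where "f y = (u y)\<^sup>2 / norm (x - y) - (u y)\<^sup>2 / norm (R x - y)" for y
  define g where "g y = 2 * k * D * (u y / (norm (x - y))\<^sup>2)" for y
  have norms: "norm (R x - R y) = norm (x - y)" "norm (R x - y) = norm (x - R y)" "R (R y) = y" for y
    unfolding R_def using norm_mirror_diff[OF e] norm_diff_mirror_commute[OF e] e by auto
  have g0: "0 \<le> g y" for y unfolding g_def using k D u_nonneg by simp
  have ff: "f y + f (R y) = ((u y)\<^sup>2 - (u (R y))\<^sup>2) * (1 / norm (x - y) - 1 / norm (x - R y))" for y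
    by (simp add: f_def norms algebra_simps)
  have half: "f y + f (R y) \<le> g y" if y: "e \<bullet> y \<le> l" "y \<noteq> x" for y
  proof -
    define a b where "a = norm (x - y)" and "b = norm (x - R y)"
    have a: "0 < a" using y by (simp add: a_def)
    have ab: "a \<le> b" unfolding a_def b_def R_def using norm_diff_le_mirror[OF e] x y by simp
    have b: "0 < b" using a ab by simp
    have "norm (x - R y) \<le> norm (x - R x) + norm (R x - R y)" by norm
    then have bD: "b \<le> D + a" by (simp add: norms D a_def b_def)
    have H: "1 / a - 1 / b \<le> D / a\<^sup>2"
    proof -
      have "1 / a - 1 / b = (b - a) / (a * b)" using a b by (simp add: field_simps)
      also have "\<dots> \<le> D / (a * a)" using a ab bD by (intro frac_le mult_left_mono) auto
      finally show ?thesis by (simp add: power2_eq_square)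
    qed
    have H0: "0 \<le> 1 / a - 1 / b" using a ab by (simp add: frac_le)
    show ?thesis
    proof (cases "u y \<le> u (R y)")
      case True
      then have "(u y)\<^sup>2 - (u (R y))\<^sup>2 \<le> 0" using u_nonneg by (simp add: power_mono)
      then have "f y + f (R y) \<le> 0"
        unfolding ff using H0 by (intro mult_nonpos_nonneg) (auto simp: a_def b_def)
      then show ?thesis using g0[of y] by linarith
    next
      case False
      have "u y - u (R y) \<le> k" using gap[OF y(1)] by (simp add: reflection_gap_def R_def)
      then have "(u y - u (R y)) * (u y + u (R y)) \<le> k * (2 * u y)"
        using False u_nonneg[of y] u_nonneg[of "R y"] k by (intro mult_mono) auto
      then have "(u y)\<^sup>2 - (u (R y))\<^sup>2 \<le> 2 * k * u y"
        by (simp add: power2_eq_square algebra_simps)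
      then have "f y + f (R y) \<le> (2 * k * u y) * (D / a\<^sup>2)"
        unfolding ff using H H0 k u_nonneg by (intro mult_mono) (auto simp: a_def b_def)
      then show ?thesis by (simp add: g_def a_def mult_ac)
    qed
  qed
  \<comment> \<open>At \<open>x\<close> and its mirror image one of the two kernels degenerates to \<open>1 / 0 = 0\<close>.\<close>
  have le: "AE y in lebesgue. f y + f (R y) \<le> g y + g (R y)"
    using AE_neq_point[of x] AE_neq_point[of "R x"]
  proof eventually_elim
    case (elim y)
    show ?case
    proof (cases "e \<bullet> y \<le> l")
      case True
      then show ?thesis using half[of y] elim g0[of "R y"] by linarith
    next
      case False
      then have "e \<bullet> R y \<le> l" using e by (simp add: R_def inner_mirror)
      moreover have "R y \<noteq> x" using elim norms(3)[of y] by auto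
      ultimately show ?thesis using half[of "R y"] g0[of y] norms(3)[of y] by simp
    qed
  qed
  have "(LINT y|lebesgue. f y) \<le> (LINT y|lebesgue. g y)"
  proof (rule integral_mirror_symmetrize[OF e])
    show "integrable lebesgue f" unfolding f_def
      by (intro Bochner_Integration.integrable_diff hartree_integrable)
    show "integrable lebesgue g" unfolding g_def by (intro integrable_mult_right riesz_potential_integrable)
  qed (use le in \<open>simp add: R_def\<close>)
  moreover have "(LINT y|lebesgue. f y) = hartree_potential u x - hartree_potential u (R x)"
    unfolding f_def hartree_potential_def
    by (intro Bochner_Integration.integral_diff hartree_integrable)
  moreover have "(LINT y|lebesgue. g y) = 2 * k * D * riesz_potential x"
    unfolding g_def riesz_potential_def by (rule integral_mult_right_zero)
  ultimately show ?thesis by (simp add: R_def D_def mult.assoc mult.left_commute)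
qed

definition pv_op :: "real^3 \<Rightarrow> real" where
  "pv_op x = pv_integral x (\<lambda>y. (u x - u y) * j (norm (x - y)))"

lemma pv_op_limit:
  "((\<lambda>\<epsilon>. LINT y|lebesgue. indicator {y. \<epsilon> < norm (x - y)} y * ((u x - u y) * j (norm (x - y)))) \<longlongrightarrow> pv_op x)
     (at_right 0)"
proof -
  obtain L where "(pv_truncated x (\<lambda>y. (u x - u y) * j (norm (x - y))) \<longlongrightarrow> L) (at_right 0)"
    using pv[of x] by (auto simp: pv_integrable_def)
  moreover from this have "pv_op x = L"
    unfolding pv_op_def pv_integral_def by (intro tendsto_Lim) auto
  moreover have "pv_truncated x (\<lambda>y. (u x - u y) * j (norm (x - y))) =
    (\<lambda>\<epsilon>. LINT y|lebesgue. indicator {y. \<epsilon> < norm (x - y)} y * ((u x - u y) * j (norm (x - y))))"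
    by (auto simp: pv_truncated_def set_lebesgue_integral_def fun_eq_iff)
  ultimately show ?thesis by simp
qed

lemma truncation_integrable:
  "0 < \<epsilon> \<Longrightarrow> integrable lebesgue (\<lambda>y. indicator {y. \<epsilon> < norm (x - y)} y * ((u x - u y) * j (norm (x - y))))"
  using pv[of x] by (auto simp: pv_integrable_def set_integrable_def)

text \<open>The nonlocal maximum principle, in one form for both of its uses. Folding the truncated
  integrals gives on the half space the integrand
  \<open>(w x - w y) j (norm (x - y)) + (w x + w y) j (norm (x - R y))\<close>, with \<open>R\<close> the reflection and \<open>w\<close>
  the gap. At a nonpositive minimum of \<open>w\<close> it is at most \<open>2 w x j (norm (x - R y)) \<le> 0\<close>, since
  \<open>R y\<close> is farther from \<open>x\<close> than \<open>y\<close>. A definite gain on one ball therefore survives in the limit.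
  In the excised ball around \<open>x\<close> only the second term is left, which is bounded, so that its
  contribution vanishes with the volume of the ball.\<close>
lemma pv_op_gap:
  assumes e: "norm e = 1" and x: "e \<bullet> x < l"
    and min: "\<And>y. e \<bullet> y \<le> l \<Longrightarrow> reflection_gap e l x \<le> reflection_gap e l y"
    and nonpos: "reflection_gap e l x \<le> 0"
    and half_ball: "\<And>y. y \<in> ball z r \<Longrightarrow> e \<bullet> y < l"
    and away: "0 < \<delta>" "\<And>y. y \<in> ball z r \<Longrightarrow> \<delta> < norm (x - y)"
    and gain: "\<And>y. y \<in> ball z r \<Longrightarrow>
       (reflection_gap e l x - reflection_gap e l y) * j (norm (x - y))
     + (reflection_gap e l x + reflection_gap e l y) * j (norm (x - mirror e l y)) \<le> - c"
  shows "pv_op (mirror e l x) - pv_op x \<le> - c * measure lebesgue (ball z r)"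
proof -
  define R where "R = mirror e l"
  define w where "w = reflection_gap e l"
  define d where "d = l - e \<bullet> x"
  have d: "0 < d" using x by (simp add: d_def)
  obtain B where B: "B > 0" "\<And>x. u x \<le> B" "\<And>x. norm x * u x \<le> B"
    using u_bounded by blast
  have norms: "norm (R x - R y) = norm (x - y)" "norm (R x - y) = norm (x - R y)" "R (R y) = y" for y
    unfolding R_def using norm_mirror_diff[OF e] norm_diff_mirror_commute[OF e] e by auto
  have wR: "w (R y) = - w y" for y unfolding w_def R_def by (rule reflection_gap_mirror[OF e])
  define T where "T x \<epsilon> = (LINT y|lebesgue. indicator {y. \<epsilon> < norm (x - y)} y * ((u x - u y) * j (norm (x - y))))" for x \<epsilon>
  define V where "V = measure lebesgue (ball z r)"
  have trunc: "T (R x) \<epsilon> - T x \<epsilon> \<le> - c * V + B * j d * measure lebesgue (cball x \<epsilon>)"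
    if \<epsilon>: "0 < \<epsilon>" "\<epsilon> < \<delta>" "\<epsilon> < d" for \<epsilon>
  proof -
    define f where "f y = indicator {y. \<epsilon> < norm (x - y)} y * ((w x - w y) * j (norm (x - y)))" for y
    define b where "b y = - c * indicator (ball z r) y + B * j d * indicator (cball x \<epsilon>) y" for y
    define F where "F y = indicator {y. \<epsilon> < norm (R x - y)} y * ((u (R x) - u y) * j (norm (R x - y)))" for y
    have Fi: "integrable lebesgue F" unfolding F_def by (rule truncation_integrable[OF \<epsilon>(1)])
    have FR: "F (R y) = indicator {y. \<epsilon> < norm (x - y)} y * ((u (R x) - u (R y)) * j (norm (x - y)))" for y
      by (simp add: F_def norms indicator_def)
    have fF: "f = (\<lambda>y. F (R y) - indicator {y. \<epsilon> < norm (x - y)} y * ((u x - u y) * j (norm (x - y))))"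
      unfolding FR by (auto simp: f_def fun_eq_iff w_def reflection_gap_def R_def algebra_simps)
    have FRi: "integrable lebesgue (\<lambda>y. F (R y))" "(LINT y|lebesgue. F (R y)) = T (R x) \<epsilon>"
      using integrable_mirror[OF e Fi] integral_mirror[OF e Fi] by (auto simp: R_def T_def F_def)
    have fi: "integrable lebesgue f"
      unfolding fF by (intro Bochner_Integration.integrable_diff FRi truncation_integrable \<epsilon>)
    have fint: "(LINT y|lebesgue. f y) = T (R x) \<epsilon> - T x \<epsilon>"
      unfolding fF
      by (subst Bochner_Integration.integral_diff) (simp_all only: FRi truncation_integrable \<epsilon> T_def)
    have b_nonneg: "0 \<le> b y" if "l \<le> e \<bullet> y" for y
      using that half_ball[of y] B j_pos[OF d] by (auto simp: b_def indicator_def)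
    have half: "f y + f (R y) \<le> b y" if y: "e \<bullet> y \<le> l" for y
    proof -
      define J1 J2 where "J1 = j (norm (x - y))" and "J2 = j (norm (x - R y))"
      have dR: "d \<le> norm (x - R y)"
        using plane_dist_le_norm_diff_mirror[OF e, of x l y] x y by (simp add: d_def R_def)
      have J2: "0 < J2" "J2 \<le> j d"
        using less_le_trans[OF d dR] j_pos j_antimono[OF d dR] by (auto simp only: J2_def)
      have fR: "f (R y) = (w x + w y) * J2"
        using dR \<epsilon> by (simp add: f_def norms wR J2_def indicator_def)
      have wmin: "w x \<le> w y" "w x \<le> 0" using min[OF y] nonpos by (auto simp: w_def)
      show ?thesis
      proof (cases "\<epsilon> < norm (x - y)")
        case False
        have "w y \<le> B" using B(2)[of "mirror e l y"] u_nonneg[of y] by (simp add: w_def reflection_gap_def)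
        have "f y + f (R y) = (w x + w y) * J2" using False by (simp add: fR) (simp add: f_def)
        also have "\<dots> \<le> B * j d" using J2 wmin \<open>w y \<le> B\<close> B(1) by (intro mult_mono) auto
        also have "\<dots> = b y" using False away(2)[of y] \<epsilon> by (auto simp: b_def indicator_def dist_norm)
        finally show ?thesis .
      next
        case True
        then have J1: "J2 \<le> J1" unfolding J1_def J2_def R_def
          using norm_diff_le_mirror[OF e, of x l y] x y \<epsilon> by (intro j_antimono) auto
        have eq: "f y + f (R y) = (w x - w y) * J1 + (w x + w y) * J2"
          using True by (simp add: fR) (simp add: f_def J1_def)
        show ?thesis
        proof (cases "y \<in> ball z r")
          case in_ball: True
          then show ?thesis using gain[OF in_ball] True unfolding eq
            by (simp add: b_def w_def J1_def J2_def R_def dist_norm)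
        next
          case False
          have "(w x - w y) * J1 \<le> (w x - w y) * J2" using J1 wmin by (intro mult_left_mono_neg) auto
          then have "f y + f (R y) \<le> 2 * w x * J2" unfolding eq by (simp add: algebra_simps)
          also have "\<dots> \<le> 0" using wmin J2 by (simp add: mult_nonpos_nonneg)
          also have "0 \<le> b y" using False B j_pos[OF d] by (simp add: b_def)
          finally show ?thesis .
        qed
      qed
    qed
    have "(LINT y|lebesgue. f y) \<le> (LINT y|lebesgue. b y)"
    proof (rule integral_mirror_symmetrize[OF e fi, where l = l])
      show "integrable lebesgue b" unfolding b_def
        by (intro Bochner_Integration.integrable_add integrable_mult_right integrable_real_indicator)
           (auto simp: emeasure_lborel_ball_finite[unfolded infinity_ennreal_def]
              emeasure_lborel_cball_finite[unfolded infinity_ennreal_def])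
      show "AE y in lebesgue. f y + f (mirror e l y) \<le> b y + b (mirror e l y)"
      proof (intro AE_I2)
        fix y
        show "f y + f (mirror e l y) \<le> b y + b (mirror e l y)"
        proof (cases "e \<bullet> y \<le> l")
          case True
          then have "0 \<le> b (R y)" using e by (intro b_nonneg) (simp add: R_def inner_mirror)
          then show ?thesis using half[OF True] by (simp add: R_def)
        next
          case False
          then have "e \<bullet> R y \<le> l" using e by (simp add: R_def inner_mirror)
          from half[OF this] have "f (R y) + f y \<le> b (R y)" by (simp add: norms)
          moreover have "0 \<le> b y" using False by (intro b_nonneg) auto
          ultimately show ?thesis by (simp add: R_def)
        qed
      qed
    qed
    also have "(LINT y|lebesgue. b y) = - c * V + B * j d * measure lebesgue (cball x \<epsilon>)"
      unfolding b_def V_def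
      by (subst Bochner_Integration.integral_add)
         (auto intro!: integrable_mult_right integrable_real_indicator
            simp: emeasure_lborel_ball_finite[unfolded infinity_ennreal_def]
              emeasure_lborel_cball_finite[unfolded infinity_ennreal_def])
    finally show ?thesis by (simp add: fint)
  qed
  have lim1: "((\<lambda>\<epsilon>. T (R x) \<epsilon> - T x \<epsilon>) \<longlongrightarrow> pv_op (R x) - pv_op x) (at_right 0)"
    unfolding T_def by (intro tendsto_diff pv_op_limit)
  have lim2: "((\<lambda>\<epsilon>. - c * V + B * j d * (4 / 3 * pi * \<epsilon> ^ 3)) \<longlongrightarrow> - c * V + B * j d * (4 / 3 * pi * 0 ^ 3)) (at_right 0)"
    by (intro tendsto_intros)
  have "pv_op (R x) - pv_op x \<le> - c * V + B * j d * (4 / 3 * pi * 0 ^ 3)"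
  proof (rule tendsto_le[OF _ lim2 lim1])
    show "eventually (\<lambda>\<epsilon>. T (R x) \<epsilon> - T x \<epsilon> \<le> - c * V + B * j d * (4 / 3 * pi * \<epsilon> ^ 3)) (at_right 0)"
      unfolding eventually_at_right_field
    proof (intro exI[of _ "min \<delta> d"] conjI allI impI)
      show "0 < min \<delta> d" using away d by simp
      fix \<epsilon> :: real assume "0 < \<epsilon>" "\<epsilon> < min \<delta> d"
      then show "T (R x) \<epsilon> - T x \<epsilon> \<le> - c * V + B * j d * (4 / 3 * pi * \<epsilon> ^ 3)"
        using trunc[of \<epsilon>] by (simp add: content_cball unit_ball_vol_3)
    qed
  qed simp
  then show ?thesis by (simp add: R_def V_def)
qed

text \<open>Of the two ways to split the difference of the right-hand sides at \<open>mirror e l x\<close> and \<open>x\<close>,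
  this one multiplies the gap by the Hartree potential at \<open>x\<close>: at a negative minimum in a far half
  space \<open>x\<close> is far from the origin, whereas its mirror image need not be.\<close>
lemma equation_gap:
  "A * (pv_op (mirror e l x) - pv_op x) + \<mu> * reflection_gap e l x
   = hartree_potential u x * reflection_gap e l x
     - u (mirror e l x) * (hartree_potential u x - hartree_potential u (mirror e l x))"
  using equation[of x] equation[of "mirror e l x"]
  unfolding pv_op_def[symmetric] reflection_gap_def by (simp add: algebra_simps)

text \<open>At a negative minimum the gain in \<open>pv_op_gap\<close> is taken on a ball at distance comparable
  with \<open>d\<close> from \<open>x\<close>: its volume is of order \<open>d\<^sup>3\<close>, and mirror images of its points are within
  \<open>3 d\<close> of \<open>x\<close>. The common negative factor \<open>w x\<close> is then divided out of the equation, with \<open>w\<close> the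
  gap.\<close>
lemma negative_minimum_estimate:
  assumes e: "norm e = 1" and x: "e \<bullet> x < l"
    and min: "\<And>y. e \<bullet> y \<le> l \<Longrightarrow> reflection_gap e l x \<le> reflection_gap e l y"
    and neg: "reflection_gap e l x < 0"
  defines "d \<equiv> l - e \<bullet> x"
  shows "A * pi / 24 * (d ^ 3 * j (3 * d)) + \<mu> \<le> hartree_potential u x + 4 * u x * d * riesz_potential x"
proof -
  define w where "w = reflection_gap e l x"
  have d: "0 < d" using x by (simp add: d_def)
  \<comment> \<open>The ball of radius \<open>d / 4\<close> around \<open>z\<close> lies in the half space, at distances between \<open>d / 2\<close> and \<open>d\<close> from \<open>x\<close>.\<close>
  define z where "z = x - (3 * d / 4) *\<^sub>R e"
  have zx: "norm (x - z) = 3 * d / 4" using e d by (simp add: z_def)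
  have ee: "e \<bullet> e = 1" using e by (simp add: dot_square_norm)
  have nb: "d / 2 < norm (x - y)" "norm (x - y) < d" if "y \<in> ball z (d / 4)" for y
  proof -
    have "norm (z - y) < d / 4" using that by (simp add: dist_norm)
    moreover have "norm (x - z) \<le> norm (x - y) + norm (z - y)" by norm
    moreover have "norm (x - y) \<le> norm (x - z) + norm (z - y)" by norm
    ultimately show "d / 2 < norm (x - y)" "norm (x - y) < d" using zx by linarith+
  qed
  have hb: "e \<bullet> y < l" if "y \<in> ball z (d / 4)" for y
  proof -
    have "e \<bullet> (y - x) \<le> norm (y - x)" using norm_cauchy_schwarz[of e "y - x"] e by simp
    then show ?thesis using nb[OF that] by (simp add: inner_diff_right d_def norm_minus_commute)
  qed
  have "pv_op (mirror e l x) - pv_op x \<le> - (- 2 * w * j (3 * d)) * measure lebesgue (ball z (d / 4))"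
  proof (rule pv_op_gap[OF e x min _ hb, where \<delta> = "d / 2"])
    fix y assume y: "y \<in> ball z (d / 4)"
    define J1 J2 where "J1 = j (norm (x - y))" and "J2 = j (norm (x - mirror e l y))"
    have pos: "0 < norm (x - y)" using nb[OF y] d by linarith
    have le: "norm (x - y) \<le> norm (x - mirror e l y)" using norm_diff_le_mirror[OF e] x hb[OF y] by simp
    have "norm (x - mirror e l y) \<le> norm (x - mirror e l x) + norm (mirror e l x - mirror e l y)" by norm
    also have "\<dots> \<le> 2 * d + d"
      using norm_self_diff_mirror[OF e, of x l] norm_mirror_diff[OF e, of l x y] nb[OF y] x by (simp add: d_def)
    finally have J: "J2 \<le> J1" "j (3 * d) \<le> J2"
      unfolding J1_def J2_def using pos le by (auto intro!: j_antimono)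
    have "(w - reflection_gap e l y) * J1 \<le> (w - reflection_gap e l y) * J2"
      using J min[of y] hb[OF y] by (intro mult_left_mono_neg) (auto simp: w_def)
    then have "(w - reflection_gap e l y) * J1 + (w + reflection_gap e l y) * J2 \<le> 2 * w * J2"
      by (simp add: algebra_simps)
    also have "\<dots> \<le> 2 * w * j (3 * d)" using J neg by (intro mult_left_mono_neg) (auto simp: w_def)
    finally show "(reflection_gap e l x - reflection_gap e l y) * j (norm (x - y))
      + (reflection_gap e l x + reflection_gap e l y) * j (norm (x - mirror e l y)) \<le> - (- 2 * w * j (3 * d))"
      by (simp add: w_def J1_def J2_def)
  qed (use neg d nb in auto)
  also have "measure lebesgue (ball z (d / 4)) = pi / 48 * d ^ 3"
    using d by (simp add: content_ball unit_ball_vol_3 power_divide)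
  finally have "pv_op (mirror e l x) - pv_op x \<le> w * (pi / 24 * (d ^ 3 * j (3 * d)))"
    by (simp add: algebra_simps)
  then have 1: "A * (pv_op (mirror e l x) - pv_op x) \<le> A * (w * (pi / 24 * (d ^ 3 * j (3 * d))))"
    using A_pos by (intro mult_left_mono) auto
  have 2: "hartree_potential u x - hartree_potential u (mirror e l x) \<le> 4 * (- w) * d * riesz_potential x"
    unfolding d_def by (rule hartree_potential_gap[OF e x]) (use neg min in \<open>auto simp: w_def\<close>)
  have "u (mirror e l x) * (hartree_potential u x - hartree_potential u (mirror e l x))
      \<le> u (mirror e l x) * (4 * (- w) * d * riesz_potential x)"
    using 2 u_nonneg by (rule mult_left_mono)
  also have "\<dots> \<le> u x * (4 * (- w) * d * riesz_potential x)"
    using neg d riesz_potential_nonneg[of x] by (intro mult_right_mono) (auto simp: reflection_gap_def w_def mult_nonpos_nonneg)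
  finally have "hartree_potential u x * w - u x * (4 * (- w) * d * riesz_potential x)
      \<le> A * (w * (pi / 24 * (d ^ 3 * j (3 * d)))) + \<mu> * w"
    using equation_gap[of e l x] 1 unfolding w_def[symmetric] by linarith
  then have "w * (hartree_potential u x + 4 * u x * d * riesz_potential x)
      \<le> w * (A * pi / 24 * (d ^ 3 * j (3 * d)) + \<mu>)"
    by (simp add: algebra_simps)
  then show ?thesis using neg by (simp add: w_def mult_le_cancel_left_neg)
qed

text \<open>At an interior zero of a nonnegative gap the equation makes the difference of the
  principal values nonnegative, while a point with positive gap would contribute a negative
  amount, because \<open>j\<close> is strictly decreasing.\<close>
lemma strong_maximum_principle:
  assumes e: "norm e = 1" and x: "e \<bullet> x < l" and y0: "e \<bullet> y0 < l"
    and nonneg: "\<And>y. e \<bullet> y \<le> l \<Longrightarrow> 0 \<le> reflection_gap e l y"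
    and zero: "reflection_gap e l x = 0"
  shows "reflection_gap e l y0 = 0"
proof (rule ccontr)
  define w where "w = reflection_gap e l"
  assume "reflection_gap e l y0 \<noteq> 0"
  then have w0: "w y0 > 0" using nonneg[of y0] y0 by (simp add: w_def)
  then have ne: "x \<noteq> y0" using zero by (auto simp: w_def)
  define J where "J y = j (norm (x - y)) - j (norm (x - mirror e l y))" for y
  have "continuous_on UNIV w" unfolding w_def reflection_gap_def
    by (intro continuous_intros u_continuous)
  then have cw: "isCont w y0" by (simp add: continuous_on_eq_continuous_at)
  define a b where "a = norm (x - y0)" and "b = norm (x - mirror e l y0)"
  have ab: "0 < a" "a < b" unfolding a_def b_def using ne norm_diff_less_mirror[OF e x y0] by auto
  \<comment> \<open>As \<open>j\<close> need not be continuous, the bound near \<open>y0\<close> compares \<open>j\<close> at two separated radii between \<open>a\<close> and \<open>b\<close>.\<close>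
  define t where "t = (b - a) / 3"
  have t: "0 < t" "a + t < b - t" using ab by (auto simp: t_def field_simps)
  define c0 where "c0 = j (a + t) - j (b - t)"
  have c0: "0 < c0" using j_strict[of "a + t" "b - t"] ab t by (simp add: c0_def)
  obtain s where s: "s > 0" "\<And>y. dist y y0 < s \<Longrightarrow> dist (w y) (w y0) < w y0 / 2"
    using cw w0 unfolding continuous_at_eps_delta by (metis half_gt_zero)
  define r where "r = min (min s t) (min (a / 2) (l - e \<bullet> y0))"
  have r: "0 < r" "r \<le> s" "r \<le> t" "r \<le> a / 2" "r \<le> l - e \<bullet> y0"
    using s t ab y0 unfolding r_def by linarith+
  have near: "norm (y0 - y) < r" if "y \<in> ball y0 r" for y using that by (simp add: dist_norm)
  have hb: "e \<bullet> y < l" if "y \<in> ball y0 r" for y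
  proof -
    have "e \<bullet> (y - y0) \<le> norm (y0 - y)" using norm_cauchy_schwarz[of e "y - y0"] e
      by (simp add: norm_minus_commute)
    then show ?thesis using near[OF that] r by (simp add: inner_diff_right)
  qed
  define c where "c = w y0 / 2 * c0"
  have c: "0 < c" using w0 c0 by (simp add: c_def)
  have "pv_op (mirror e l x) - pv_op x \<le> - c * measure lebesgue (ball y0 r)"
  proof (rule pv_op_gap[OF e x _ _ hb, where \<delta> = "a / 2"])
    fix y assume y: "y \<in> ball y0 r"
    have n1: "norm (x - y0) \<le> norm (x - y) + norm (y0 - y)" by norm
    have n2: "norm (x - y) \<le> norm (x - y0) + norm (y0 - y)" by norm
    have "norm (x - mirror e l y0) \<le> norm (x - mirror e l y) + norm (mirror e l y0 - mirror e l y)" by norm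
    then have n3: "b \<le> norm (x - mirror e l y) + norm (y0 - y)"
      by (simp add: b_def norm_mirror_diff[OF e])
    show away: "a / 2 < norm (x - y)" using n1 near[OF y] r by (simp add: a_def)
    have "j (a + t) \<le> j (norm (x - y))"
      using away n2 near[OF y] r ab by (intro j_antimono) (auto simp: a_def)
    moreover have "j (norm (x - mirror e l y)) \<le> j (b - t)"
      using n3 near[OF y] r t ab by (intro j_antimono) auto
    ultimately have "c0 \<le> J y" by (simp add: c0_def J_def)
    moreover have "\<bar>w y - w y0\<bar> < w y0 / 2"
      using s(2)[of y] near[OF y] r by (simp add: dist_real_def dist_norm norm_minus_commute)
    then have "w y0 / 2 \<le> w y" by linarith
    ultimately have "c \<le> w y * J y" unfolding c_def using w0 c0 by (intro mult_mono) auto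
    then show "(reflection_gap e l x - reflection_gap e l y) * j (norm (x - y))
      + (reflection_gap e l x + reflection_gap e l y) * j (norm (x - mirror e l y)) \<le> - c"
      by (simp add: zero w_def J_def algebra_simps)
  qed (use zero nonneg ab c in auto)
  also have "\<dots> < 0" using c r by (simp add: mult_pos_pos)
  finally have "A * (pv_op (mirror e l x) - pv_op x) < 0" using A_pos by (simp add: mult_pos_neg)
  moreover have "hartree_potential u x - hartree_potential u (mirror e l x) \<le> 4 * 0 * (l - e \<bullet> x) * riesz_potential x"
    by (rule hartree_potential_gap[OF e x]) (use nonneg in auto)
  then have "u (mirror e l x) * (hartree_potential u x - hartree_potential u (mirror e l x)) \<le> 0"
    using u_nonneg by (intro mult_nonneg_nonpos) auto
  ultimately show False using equation_gap[of e l x] zero by simp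
qed

section \<open>Moving the plane\<close>

lemma gap_continuous:
  "continuous_on S f \<Longrightarrow> continuous_on S g \<Longrightarrow> continuous_on S (\<lambda>z. reflection_gap e (f z) (g z))"
  unfolding reflection_gap_def by (intro continuous_intros u_continuous)

text \<open>The gap vanishes on the plane and is at least \<open>- u\<close>, which tends to 0 at infinity, so a
  negative infimum is attained at an interior point.\<close>
lemma negative_minimum_exists:
  assumes e: "norm e = 1" and y: "e \<bullet> y \<le> l" "reflection_gap e l y < 0"
  obtains x where "e \<bullet> x < l" "reflection_gap e l x < 0"
    "\<And>y. e \<bullet> y \<le> l \<Longrightarrow> reflection_gap e l x \<le> reflection_gap e l y"
proof -
  define w where "w = reflection_gap e l"
  define \<epsilon> where "\<epsilon> = - w y"
  have \<epsilon>: "\<epsilon> > 0" using y by (simp add: \<epsilon>_def w_def)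
  obtain R where R: "R > 0" "\<And>x. R \<le> norm x \<Longrightarrow> norm x * u x \<le> \<epsilon> / 2"
    by (rule u_small[OF half_gt_zero[OF \<epsilon>]]) blast
  define K where "K = {x. e \<bullet> x \<le> l} \<inter> cball 0 (max R 1)"
  have out: "w y < w x" if "e \<bullet> x \<le> l" "x \<notin> K" for x
  proof -
    have n: "1 \<le> norm x" "R \<le> norm x" using that by (auto simp: K_def)
    have "1 * u x \<le> norm x * u x" using n u_nonneg[of x] by (intro mult_right_mono) auto
    then have "u x < \<epsilon>" using R(2)[OF n(2)] \<epsilon> by linarith
    then show ?thesis using u_nonneg[of "mirror e l x"] by (simp add: \<epsilon>_def w_def reflection_gap_def)
  qed
  have yK: "y \<in> K" using out[of y] y by auto
  have "closed {x. e \<bullet> x \<le> l}" by (rule closed_halfspace_le)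
  then have "compact K" unfolding K_def by (intro closed_Int_compact) auto
  moreover have "continuous_on K w" unfolding w_def by (intro gap_continuous continuous_intros)
  ultimately obtain x where x: "x \<in> K" "\<And>z. z \<in> K \<Longrightarrow> w x \<le> w z"
    using continuous_attains_inf[of K w] yK by blast
  have xy: "w x \<le> w y" using x(2)[OF yK] .
  have neg: "w x < 0" using xy \<epsilon> by (simp add: \<epsilon>_def)
  show thesis
  proof (rule that)
    show "reflection_gap e l x < 0" using neg by (simp add: w_def)
    have "mirror e l x = x" if "e \<bullet> x = l" using that by (simp add: mirror_def)
    then have "e \<bullet> x \<noteq> l" using neg by (auto simp: w_def reflection_gap_def)
    then show "e \<bullet> x < l" using x(1) by (auto simp: K_def)
    fix z assume z: "e \<bullet> z \<le> l"
    show "reflection_gap e l x \<le> reflection_gap e l z"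
      using x(2)[of z] out[OF z] xy by (cases "z \<in> K") (auto simp: w_def)
  qed
qed

text \<open>By \<open>negative_minimum_estimate\<close> the zero order coefficient exceeds \<open>\<mu>\<close> at a negative
  minimum, which fails far out; and it exceeds a multiple of \<open>d\<^sup>3 j (3 d)\<close>, which fails close to
  the plane.\<close>
lemma negative_minimum_location:
  assumes L: "0 \<le> L"
  obtains R \<delta> where "R > 0" "\<delta> > 0"
    "\<And>e l x. \<lbrakk>norm e = 1; l \<le> L; e \<bullet> x < l; reflection_gap e l x < 0;
        \<And>y. e \<bullet> y \<le> l \<Longrightarrow> reflection_gap e l x \<le> reflection_gap e l y\<rbrakk>
       \<Longrightarrow> norm x < R \<and> \<delta> \<le> l - e \<bullet> x"
proof -
  obtain R Q where R: "R > 0"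
    and Q: "\<And>x d. d \<le> L + norm x \<Longrightarrow> 0 \<le> d \<Longrightarrow> hartree_potential u x + 4 * u x * d * riesz_potential x \<le> Q"
    and far: "\<And>x d. R \<le> norm x \<Longrightarrow> 0 \<le> d \<Longrightarrow> d \<le> L + norm x \<Longrightarrow> hartree_potential u x + 4 * u x * d * riesz_potential x < \<mu>"
    using coefficient_bounds[OF L] by blast
  have "eventually (\<lambda>d. 24 * (\<bar>Q\<bar> + 1) / (A * pi) \<le> d ^ 3 * j (3 * d)) (at_right 0)"
    using j_blowup unfolding filterlim_at_top by blast
  then obtain \<delta> where \<delta>: "\<delta> > 0"
    "\<And>d. 0 < d \<Longrightarrow> d < \<delta> \<Longrightarrow> 24 * (\<bar>Q\<bar> + 1) / (A * pi) \<le> d ^ 3 * j (3 * d)"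
    unfolding eventually_at_right_field by blast
  have "norm x < R \<and> \<delta> \<le> l - e \<bullet> x"
    if e: "norm e = 1" and l: "l \<le> L" and x: "e \<bullet> x < l" and neg: "reflection_gap e l x < 0"
      and min: "\<And>y. e \<bullet> y \<le> l \<Longrightarrow> reflection_gap e l x \<le> reflection_gap e l y" for e l x
  proof -
    define d where "d = l - e \<bullet> x"
    have d: "0 < d" using x by (simp add: d_def)
    have "- (e \<bullet> x) \<le> norm x" using norm_cauchy_schwarz[of "- e" x] e by simp
    then have dL: "d \<le> L + norm x" using l by (simp add: d_def)
    have est: "A * pi / 24 * (d ^ 3 * j (3 * d)) + \<mu> \<le> hartree_potential u x + 4 * u x * d * riesz_potential x"
      unfolding d_def by (rule negative_minimum_estimate[OF e x min neg])
    have "0 < d ^ 3 * j (3 * d)" using d by (simp add: j_pos)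
    then have pos: "0 < A * pi / 24 * (d ^ 3 * j (3 * d))" using A_pos by simp
    have "norm x < R"
    proof (rule ccontr)
      assume "\<not> norm x < R"
      then have "hartree_potential u x + 4 * u x * d * riesz_potential x < \<mu>" using d dL by (intro far) auto
      then show False using est pos by linarith
    qed
    moreover have "\<delta> \<le> d"
    proof (rule ccontr)
      assume "\<not> \<delta> \<le> d"
      then have "24 * (\<bar>Q\<bar> + 1) / (A * pi) \<le> d ^ 3 * j (3 * d)" using d \<delta>(2) by simp
      then have "A * pi / 24 * (24 * (\<bar>Q\<bar> + 1) / (A * pi)) \<le> A * pi / 24 * (d ^ 3 * j (3 * d))"
        using A_pos by (intro mult_left_mono) auto
      moreover have "A * pi / 24 * (24 * (\<bar>Q\<bar> + 1) / (A * pi)) = \<bar>Q\<bar> + 1" using A_pos by simp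
      ultimately show False using est Q[OF dL] d mu_pos by linarith
    qed
    ultimately show ?thesis by (simp add: d_def)
  qed
  with R \<delta>(1) show thesis using that by blast
qed

lemma u_vanishes_at_infinity:
  assumes "\<epsilon> > 0" obtains R where "R > 0" "\<And>x. R \<le> norm x \<Longrightarrow> u x < \<epsilon>"
proof -
  obtain R where R: "R > 0" "\<And>x. R \<le> norm x \<Longrightarrow> norm x * u x \<le> \<epsilon> / 2"
    by (rule u_small[OF half_gt_zero[OF assms]]) blast
  have "u x < \<epsilon>" if "max R 1 \<le> norm x" for x
  proof -
    have "1 * u x \<le> norm x * u x" using that u_nonneg[of x] by (intro mult_right_mono) auto
    then show ?thesis using R(2)[of x] that assms by auto
  qed
  then show thesis using that[of "max R 1"] R by auto
qed

text \<open>A half space that lies outside the ball of radius \<open>R\<close> has no room for a negative minimum.\<close>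
lemma moving_plane_starts:
  assumes "norm e = 1"
  obtains l where "\<And>l' x. l' \<le> l \<Longrightarrow> e \<bullet> x \<le> l' \<Longrightarrow> 0 \<le> reflection_gap e l' x"
proof -
  obtain R \<delta> where R: "R > 0" "\<delta> > 0"
    "\<And>e l x. \<lbrakk>norm e = 1; l \<le> 0; e \<bullet> x < l; reflection_gap e l x < 0;
        \<And>y. e \<bullet> y \<le> l \<Longrightarrow> reflection_gap e l x \<le> reflection_gap e l y\<rbrakk>
       \<Longrightarrow> norm x < R \<and> \<delta> \<le> l - e \<bullet> x"
    using negative_minimum_location[of 0] by auto
  have "0 \<le> reflection_gap e l' x" if l': "l' \<le> - R" "e \<bullet> x \<le> l'" for l' x
  proof (rule ccontr)
    assume "\<not> 0 \<le> reflection_gap e l' x"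
    then have neg: "reflection_gap e l' x < 0" by simp
    obtain z where z: "e \<bullet> z < l'" "reflection_gap e l' z < 0"
      "\<And>y. e \<bullet> y \<le> l' \<Longrightarrow> reflection_gap e l' z \<le> reflection_gap e l' y"
      by (rule negative_minimum_exists[OF assms l'(2) neg]) blast
    have "norm z < R" using R(3)[OF assms _ z] l' R(1) by simp
    moreover have "- (e \<bullet> z) \<le> norm z" using norm_cauchy_schwarz[of "- e" z] assms by simp
    ultimately show False using z(1) l' by linarith
  qed
  then show thesis by (rule that)
qed

text \<open>Far planes map \<open>x0\<close> to points where \<open>u\<close> is smaller than at \<open>x0\<close>.\<close>
lemma moving_plane_stops:
  assumes e: "norm e = 1" and nz: "0 < u x0"
  obtains l where "e \<bullet> x0 \<le> l" "reflection_gap e l x0 < 0"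
proof -
  obtain R where R: "R > 0" "\<And>x. R \<le> norm x \<Longrightarrow> u x < u x0" using u_vanishes_at_infinity[OF nz] by blast
  define l where "l = \<bar>e \<bullet> x0\<bar> + R"
  have "R \<le> e \<bullet> mirror e l x0" using e R by (simp add: inner_mirror l_def)
  also have "\<dots> \<le> norm (mirror e l x0)" using norm_cauchy_schwarz[of e "mirror e l x0"] e by simp
  finally have "u (mirror e l x0) < u x0" by (rule R(2))
  then show thesis using R by (intro that[of l]) (auto simp: l_def reflection_gap_def)
qed

text \<open>Take the supremum \<open>l0\<close> of the positions up to which all gaps are nonnegative. If the gap
  at \<open>l0\<close> were not identically zero, it would be positive in the open half space. Planes slightly
  beyond \<open>l0\<close> have negative minima in a fixed compact set and at a fixed distance from the plane,
  so a limit point of them is an interior point where the gap at \<open>l0\<close> is not positive.\<close>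
lemma critical_plane:
  assumes e: "norm e = 1" and nz: "0 < u x0"
  obtains l where "\<And>x. u (mirror e l x) = u x"
    "\<And>l' x. l' \<le> l \<Longrightarrow> e \<bullet> x \<le> l' \<Longrightarrow> u x \<le> u (mirror e l' x)"
proof -
  define P where "P l \<longleftrightarrow> (\<forall>x. e \<bullet> x \<le> l \<longrightarrow> 0 \<le> reflection_gap e l x)" for l
  define S where "S = {l. \<forall>l'\<le>l. P l'}"
  have ne: "S \<noteq> {}"
  proof -
    obtain l where "\<And>l' x. l' \<le> l \<Longrightarrow> e \<bullet> x \<le> l' \<Longrightarrow> 0 \<le> reflection_gap e l' x"
      using moving_plane_starts[OF e] by blast
    then have "l \<in> S" by (auto simp: S_def P_def)
    then show ?thesis by blast
  qed
  obtain b where b: "e \<bullet> x0 \<le> b" "reflection_gap e b x0 < 0" using moving_plane_stops[OF e nz] by blast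
  then have "\<not> P b" by (auto simp: P_def not_le)
  then have le_b: "l \<le> b" if "l \<in> S" for l using that linear[of l b] by (auto simp: S_def)
  then have bdd: "bdd_above S" by (auto simp: bdd_above_def)
  define l0 where "l0 = Sup S"
  have below: "P l" if less: "l < l0" for l
  proof -
    obtain l' where "l' \<in> S" "l < l'"
      using less less_cSup_iff[OF ne bdd, of l] unfolding l0_def by blast
    then show ?thesis by (auto simp: S_def)
  qed
  have P0: "P l0" unfolding P_def
  proof (intro allI impI)
    fix x assume x: "e \<bullet> x \<le> l0"
    show "0 \<le> reflection_gap e l0 x"
    proof (cases "e \<bullet> x = l0")
      case True
      then have "mirror e l0 x = x" by (simp add: mirror_def)
      then show ?thesis by (simp add: reflection_gap_def)
    next
      case False
      have "continuous_on UNIV (\<lambda>l. reflection_gap e l x)" by (intro gap_continuous continuous_intros)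
      then have "((\<lambda>l. reflection_gap e l x) \<longlongrightarrow> reflection_gap e l0 x) (at_left l0)"
        by (metis UNIV_I continuous_on_def tendsto_within_subset subset_UNIV)
      moreover have "eventually (\<lambda>l. 0 \<le> reflection_gap e l x) (at_left l0)"
        unfolding eventually_at_left_field
        by (rule exI[of _ "e \<bullet> x"]) (use False x below in \<open>auto simp: P_def\<close>)
      ultimately show ?thesis by (rule tendsto_lowerbound) simp
    qed
  qed
  have zero: "reflection_gap e l0 x = 0" if "e \<bullet> x < l0" for x
  proof (rule ccontr)
    assume nonzero: "reflection_gap e l0 x \<noteq> 0"
    have pos: "0 < reflection_gap e l0 y" if "e \<bullet> y < l0" for y
    proof -
      have "reflection_gap e l0 y \<noteq> 0"
        using strong_maximum_principle[OF e \<open>e \<bullet> y < l0\<close> \<open>e \<bullet> x < l0\<close>] P0 nonzero by (auto simp: P_def)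
      then show ?thesis using P0 that by (auto simp: P_def order_less_le)
    qed
    obtain R \<delta> where R: "R > 0" "\<delta> > 0"
      "\<And>e l x. \<lbrakk>norm e = 1; l \<le> \<bar>l0\<bar> + 1; e \<bullet> x < l; reflection_gap e l x < 0;
        \<And>y. e \<bullet> y \<le> l \<Longrightarrow> reflection_gap e l x \<le> reflection_gap e l y\<rbrakk>
       \<Longrightarrow> norm x < R \<and> \<delta> \<le> l - e \<bullet> x"
      using negative_minimum_location[of "\<bar>l0\<bar> + 1"] by auto
    \<comment> \<open>The possible pairs of a position beyond \<open>l0\<close> and a negative minimum for it.  Compactness of \<open>Z\<close> replaces
      the choice of a convergent subsequence.\<close>
    define Z where "Z = ({l0..l0 + 1} \<times> cball 0 R) \<inter>
       {p. reflection_gap e (fst p) (snd p) \<le> 0} \<inter> {p. \<delta> \<le> fst p - e \<bullet> snd p}"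
    have "compact Z" unfolding Z_def Int_assoc
      by (intro compact_Int_closed compact_Times closed_Int closed_Collect_le gap_continuous continuous_intros) auto
    then have "compact (fst ` Z)" by (rule compact_continuous_image[OF continuous_on_fst[OF continuous_on_id]])
    then have closed: "closed (fst ` Z)" by (rule compact_imp_closed)
    have "l0 \<in> closure (fst ` Z)"
      unfolding closure_approachable
    proof (intro allI impI)
      fix \<eta> :: real assume \<eta>: "\<eta> > 0"
      define l1 where "l1 = l0 + min 1 (\<eta> / 2)"
      have "l0 < l1" using \<eta> by (simp add: l1_def)
      then have "l1 \<notin> S" using cSup_upper[OF _ bdd] by (force simp: l0_def)
      then obtain l where l: "l \<le> l1" "\<not> P l" by (auto simp: S_def)
      have "l0 < l" using l(2) below P0 by (metis linorder_neqE)
      obtain y where y: "e \<bullet> y \<le> l" "reflection_gap e l y < 0" using l(2) by (auto simp: P_def not_le)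
      obtain z where z: "e \<bullet> z < l" "reflection_gap e l z < 0"
        "\<And>y. e \<bullet> y \<le> l \<Longrightarrow> reflection_gap e l z \<le> reflection_gap e l y"
        by (rule negative_minimum_exists[OF e y]) blast
      have "l \<le> l0 + 1" using l(1) by (simp add: l1_def)
      then have "norm z < R \<and> \<delta> \<le> l - e \<bullet> z" using R(3)[OF e _ z] by linarith
      then have "(l, z) \<in> Z" using z \<open>l0 < l\<close> \<open>l \<le> l0 + 1\<close> by (auto simp: Z_def)
      moreover have "dist l l0 < \<eta>" using l(1) \<open>l0 < l\<close> \<eta> by (auto simp: l1_def dist_real_def)
      ultimately show "\<exists>y\<in>fst ` Z. dist y l0 < \<eta>" by force
    qed
    then have "l0 \<in> fst ` Z" using closed by simp
    then obtain z where "reflection_gap e l0 z \<le> 0" "\<delta> \<le> l0 - e \<bullet> z" by (auto simp: Z_def)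
    then show False using pos[of z] R(2) by simp
  qed
  show thesis
  proof (rule that[of l0])
    fix x
    consider "e \<bullet> x < l0" | "e \<bullet> x = l0" | "e \<bullet> mirror e l0 x < l0"
      using e by (fastforce simp: inner_mirror)
    then show "u (mirror e l0 x) = u x"
    proof cases
      case 1
      then show ?thesis using zero[of x] by (simp add: reflection_gap_def)
    next
      case 2
      then show ?thesis by (simp add: mirror_def)
    next
      case 3
      then show ?thesis using zero[of "mirror e l0 x"] e by (simp add: reflection_gap_def)
    qed
  next
    fix l' x assume "l' \<le> l0" "e \<bullet> x \<le> l'"
    moreover have "P l'" using below P0 \<open>l' \<le> l0\<close> by (cases "l' = l0") auto
    ultimately show "u x \<le> u (mirror e l' x)" by (auto simp: P_def reflection_gap_def)
  qed
qed

text \<open>The multiples of a nonzero period would carry the value \<open>u x0\<close> to infinity.\<close>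
lemma no_period:
  assumes per: "\<And>x. u (x + v) = u x" and nz: "0 < u x0"
  shows "v = 0"
proof (rule ccontr)
  assume v: "v \<noteq> 0"
  obtain R where R: "R > 0" "\<And>x. R \<le> norm x \<Longrightarrow> u x < u x0" using u_vanishes_at_infinity[OF nz] by blast
  have iter: "u (x0 + real n *\<^sub>R v) = u x0" for n
  proof (induction n)
    case (Suc n)
    have "x0 + real (Suc n) *\<^sub>R v = (x0 + real n *\<^sub>R v) + v" by (simp add: algebra_simps)
    then show ?case using per Suc by metis
  qed simp
  obtain n where "(R + norm x0) / norm v \<le> real n" using real_arch_simple by blast
  then have n: "R + norm x0 \<le> norm (real n *\<^sub>R v)" using v by (simp add: field_simps)
  moreover have "norm (real n *\<^sub>R v) \<le> norm (x0 + real n *\<^sub>R v) + norm x0"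
    using norm_triangle_ineq4[of "x0 + real n *\<^sub>R v" x0] by simp
  ultimately have "R \<le> norm (x0 + real n *\<^sub>R v)" by linarith
  then show False using R(2) iter[of n] by fastforce
qed

section \<open>Symmetry in all directions\<close>

text \<open>The critical planes of the coordinate directions meet in a point \<open>p\<close>, and \<open>u\<close> is symmetric
  under the point reflection in \<open>p\<close>. Every other critical plane contains \<open>p\<close>, since its
  composition with the point reflection, applied twice, would otherwise be a nontrivial
  translation that leaves \<open>u\<close> invariant. Points at the same distance from \<open>p\<close> are exchanged by a
  reflection in a plane through \<open>p\<close>; points on a ray from \<open>p\<close> are compared by the reflection in
  the plane halfway between them.\<close>
theorem radially_decreasing: "\<exists>p. radially_decreasing_about p u"
proof (cases "\<exists>x0. 0 < u x0")
  case False
  then have "\<not> 0 < u x" for x by blast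
  then have "u x = 0" for x using u_nonneg[of x] by (simp add: order_less_le)
  then have "radially_decreasing_about 0 u"
    unfolding radially_decreasing_about_def by (intro exI[of _ "\<lambda>_. 0"]) (simp add: monotone_on_def)
  then show ?thesis by blast
next
  case True
  then obtain x0 where nz: "0 < u x0" by blast
  define good where "good e l \<longleftrightarrow> (\<forall>x. u (mirror e l x) = u x) \<and>
    (\<forall>l' x. l' \<le> l \<longrightarrow> e \<bullet> x \<le> l' \<longrightarrow> u x \<le> u (mirror e l' x))" for e l
  have ex: "\<exists>l. good e l" if "norm e = 1" for e
    using critical_plane[OF that nz] unfolding good_def by metis
  define c where "c e = (SOME l. good e l)" for e
  have c: "good e (c e)" if "norm e = 1" for e
    unfolding c_def by (rule someI_ex[OF ex[OF that]])
  define p :: "real^3" where "p = (\<chi> i. c (axis i 1))"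
  have point: "u (2 *\<^sub>R p - x) = u x" for x
  proof -
    have step: "u (mirror (axis i 1) (p $ i) y) = u y" for i y
      using c[of "axis i 1"] by (simp add: good_def p_def)
    have inner: "axis i 1 \<bullet> y = y $ i" for i and y :: "real^3" by (simp add: inner_axis')
    have "mirror (axis i 1) (p $ i) y $ k = (if k = i then 2 * p $ i - y $ i else y $ k)" for i k y
      by (simp only: mirror_def inner) (simp add: axis_def)
    then have "mirror (axis 1 1) (p $ 1) (mirror (axis 2 1) (p $ 2) (mirror (axis 3 1) (p $ 3) x)) = 2 *\<^sub>R p - x"
      by (simp add: vec_eq_iff forall_3)
    then show ?thesis using step by metis
  qed
  have through_p: "c e = e \<bullet> p" if e: "norm e = 1" for e
  proof -
    define k where "k = 4 * (c e - e \<bullet> p)"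
    have "u (x + k *\<^sub>R e) = u x" for x
    proof -
      have "mirror e (c e) (2 *\<^sub>R p - mirror e (c e) (2 *\<^sub>R p - x)) = x + k *\<^sub>R e"
      proof -
        define t where "t = c e - e \<bullet> (2 *\<^sub>R p - x)"
        have 1: "2 *\<^sub>R p - mirror e (c e) (2 *\<^sub>R p - x) = x - (2 * t) *\<^sub>R e"
          by (simp add: mirror_def t_def)
        have 2: "e \<bullet> (x - (2 * t) *\<^sub>R e) = e \<bullet> x - 2 * t" using e by (simp add: inner_diff_right dot_square_norm)
        have "mirror e (c e) (x - (2 * t) *\<^sub>R e) = x + (2 * (c e - (e \<bullet> x - 2 * t)) - 2 * t) *\<^sub>R e"
        proof -
          have "(x - a *\<^sub>R e) + b *\<^sub>R e = x + (b - a) *\<^sub>R e" for a b :: real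
            by (simp add: scaleR_diff_left)
          then show ?thesis by (simp only: mirror_def 2)
        qed
        also have "2 * (c e - (e \<bullet> x - 2 * t)) - 2 * t = k"
          by (simp add: t_def k_def inner_diff_right)
        finally show ?thesis unfolding 1 .
      qed
      then show ?thesis using c[OF e] point unfolding good_def by metis
    qed
    then have "k *\<^sub>R e = 0" using no_period[of "k *\<^sub>R e" x0] nz by blast
    then show ?thesis using e by (auto simp: k_def)
  qed
  have sym: "u (mirror e (e \<bullet> p) x) = u x" if "norm e = 1" for e x
    using c[OF that] through_p[OF that] by (simp add: good_def)
  have mono: "u x \<le> u (mirror e l x)" if "norm e = 1" "l \<le> e \<bullet> p" "e \<bullet> x \<le> l" for e l x
    using c[OF that(1)] through_p[OF that(1)] that by (simp add: good_def)
  have rad: "u x = u y" if "norm (x - p) = norm (y - p)" for x y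
  proof (cases "x = y")
    case False
    define e where "e = (1 / norm (x - y)) *\<^sub>R (x - y)"
    have e: "norm e = 1" using False by (simp add: e_def)
    have xy: "x - y = norm (x - y) *\<^sub>R e" using False by (simp add: e_def)
    have "(x - p) \<bullet> (x - p) = (y - p) \<bullet> (y - p)" using that by (simp add: norm_eq)
    then have "(x - y) \<bullet> (2 *\<^sub>R p - (x + y)) = 0" by (simp add: algebra_simps inner_commute)
    then have "e \<bullet> (2 *\<^sub>R p - (x + y)) = 0" by (simp add: e_def)
    then have "2 * (e \<bullet> p - e \<bullet> x) = - (e \<bullet> (x - y))" by (simp add: inner_diff_right inner_add_right)
    also have "e \<bullet> (x - y) = norm (x - y)" by (subst xy) (use e in \<open>simp add: dot_square_norm\<close>)
    finally have "mirror e (e \<bullet> p) x = x - norm (x - y) *\<^sub>R e" by (simp add: mirror_def)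
    also have "\<dots> = y" using xy by simp
    finally show ?thesis using sym[OF e, of x] by simp
  qed simp
  \<comment> \<open>The direction of the ray that defines the profile is arbitrary.\<close>
  define a :: "real^3" where "a = axis 1 1"
  have a: "norm a = 1" "a \<bullet> a = 1" by (simp_all add: a_def inner_axis)
  define \<phi> where "\<phi> r = u (p - r *\<^sub>R a)" for r
  have "antimono_on {0..} \<phi>"
  proof (rule monotone_onI)
    fix r r' :: real assume r: "r \<in> {0..}" "r \<le> r'"
    define l where "l = a \<bullet> p - (r + r') / 2"
    have "u (p - r' *\<^sub>R a) \<le> u (mirror a l (p - r' *\<^sub>R a))"
      by (rule mono) (use a r in \<open>auto simp: l_def inner_diff_right\<close>)
    also have "mirror a l (p - r' *\<^sub>R a) = p - r *\<^sub>R a"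
    proof -
      have shift: "2 * (l - a \<bullet> (p - r' *\<^sub>R a)) = r' - r"
        using a by (simp add: l_def inner_diff_right field_simps)
      show ?thesis unfolding mirror_def shift by (simp add: scaleR_diff_left)
    qed
    finally show "\<phi> r' \<le> \<phi> r" by (simp add: \<phi>_def)
  qed
  moreover have "u x = \<phi> (norm (x - p))" for x
    unfolding \<phi>_def by (rule rad) (simp add: a)
  ultimately show ?thesis unfolding radially_decreasing_about_def by blast
qed

end

section \<open>The pseudo-relativistic Hartree equation\<close>

theorem theorem2p27:
  fixes u :: "real^3 \<Rightarrow> real" and s m \<omega> :: real
  assumes "0 < s" and "s < 1" and "0 < m"
    and "\<omega> > - (m powr (2 * s))"
    and "u \<in> L_space s \<inter> C11_loc"
    and "\<And>x. 0 \<le> u x"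
    and "hartree_solution m s \<omega> u"
    and "integrable lebesgue (\<lambda>x. u x / (norm x)\<^sup>2)"
    and "u \<in> o[at_infinity](\<lambda>x. 1 / norm x)"
  shows "\<exists>p. radially_decreasing_about p u"
proof -
  define \<nu> where "\<nu> = 3 / 2 + s"
  define j where "j = bessel_kernel \<nu> m"
  have kernel: "frac_integrand m s u x = (\<lambda>y. (u x - u y) * j (norm (x - y)))" for x
    by (simp add: fun_eq_iff frac_integrand_def j_def bessel_kernel_def \<nu>_def)
  have "choquard_profile u j (frac_const 3 s * m powr \<nu>) (m powr (2 * s) + \<omega>)"
  proof
    show "0 < frac_const 3 s * m powr \<nu>"
      using assms(1-3) by (auto simp: frac_const_def intro!: mult_pos_pos divide_pos_pos Gamma_real_pos)
    show "0 < m powr (2 * s) + \<omega>" using assms(4) by linarith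
    show "0 < j r" if "0 < r" for r
      unfolding j_def using assms(1,3) that by (intro bessel_kernel_pos) (auto simp: \<nu>_def)
    show "j r' < j r" if "0 < r" "r < r'" for r r'
      unfolding j_def using assms(1,3) that by (intro bessel_kernel_strict_antimono) (auto simp: \<nu>_def)
    show "filterlim (\<lambda>d. d ^ 3 * j (3 * d)) at_top (at_right 0)"
      unfolding j_def using assms(1,3) by (intro bessel_kernel_blowup) (auto simp: \<nu>_def)
    show "continuous_on UNIV u"
    proof -
      obtain g where "\<And>x. GDERIV u x :> g x" using assms(5) by (auto simp: C11_loc_def)
      then show ?thesis unfolding gderiv_def
        by (intro continuous_at_imp_continuous_on ballI) (blast intro: has_derivative_continuous)
    qed
    show "((\<lambda>x. norm x * u x) \<longlongrightarrow> 0) at_infinity"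
    proof -
      have "((\<lambda>x. u x / (1 / norm x)) \<longlongrightarrow> 0) at_infinity" using assms(9) by (rule smalloD_tendsto)
      then show ?thesis by (simp add: mult.commute)
    qed
    fix x
    have sol: "pv_integrable x (frac_integrand m s u x)" "integrable lebesgue (\<lambda>y. (u y)\<^sup>2 / norm (x - y))"
      "frac_op m s u x + \<omega> * u x = hartree_potential u x * u x"
      using assms(7) by (auto simp: hartree_solution_def)
    show "0 \<le> u x" by (rule assms(6))
    show "integrable lebesgue (\<lambda>y. (u y)\<^sup>2 / norm (x - y))" by (rule sol(2))
    show "pv_integrable x (\<lambda>y. (u x - u y) * j (norm (x - y)))" using sol(1) by (simp add: kernel)
    show "frac_const 3 s * m powr \<nu> * pv_integral x (\<lambda>y. (u x - u y) * j (norm (x - y))) + (m powr (2 * s) + \<omega>) * u x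
      = hartree_potential u x * u x"
      using sol(3) by (simp add: frac_op_def kernel \<nu>_def algebra_simps)
  qed (rule assms(8))
  then show ?thesis by (rule choquard_profile.radially_decreasing)
qed

end
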